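(* Let $d\in\mathbb{N}$ and let $\varphi\colon(0,1]\to[0,d]$ be a function. Then the following are equivalent. (i) $\varphi\in\mathcal{M}(d)$. (ii) There exists a non-empty set $F\subset\mathbb{R}^d$ such that $(1-\theta)\underline{\dim}^{\theta}_{\mathrm{L}}F=\varphi(\theta)$ for all $\theta\in(0,1]$. (iii) $\varphi$ is the (pointwise) infimum of a non-empty family of functions of the form $\phi_{d,\lambda,t}$ with $\lambda\in(0,1]$ and $0\leq t\leq d(1-\lambda)$.
   Context: For a metric space $X$ (subsets of $\mathbb{R}^d$ carry the Euclidean metric), $B(x,r)$ denotes the closed ball in $X$, and $N_r(E)$ the least number of closed balls of radius $r$ required to cover $E\subset X$. For $0<\theta<1$ the monotone lower spectrum is $$\underline{\dim}^{\theta}_{\mathrm{L}}X=\sup\Bigl\{s\geq0:\exists C>0\ \forall\,0<r\leq r^\theta\leq R<1,\ \inf_{x\in X}N_r(B(x,R))\geq C\Bigl(\frac{R}{r}\Bigr)^s\Bigr\},$$ and for $\theta=1$ the expression $(1-\theta)\underline{\dim}^{\theta}_{\mathrm{L}}F$ is defined to be $0$. For $\alpha\geq0$, $\mathcal{M}(\alpha)$ denotes the set of functions $\varphi\colon(0,1]\to[0,\alpha]$ such that: $\varphi(\lambda\theta)\leq(1-\theta)\alpha+\theta\varphi(\lambda)$ for all $\lambda,\theta\in(0,1]$; and $\theta\mapsto\varphi(\theta)/(1-\theta)$ is decreasing (i.e. non-increasing) on $(0,1)$, with $\varphi(1)=0$. For $\alpha\geq0$, $\lambda\in(0,1]$ and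 $0\leq t\leq\alpha(1-\lambda)$, the function $\phi_{\alpha,\lambda,t}\colon(0,1]\to[0,\alpha]$ is given by $\phi_{\alpha,\lambda,t}(\theta)=\alpha+\frac{\theta}{\lambda}(t-\alpha)$ for $0<\theta\leq\lambda$ and $\phi_{\alpha,\lambda,t}(\theta)=t\frac{1-\theta}{1-\lambda}$ for $\lambda<\theta\leq1$. *)

theory Defs
  imports "HOL-Analysis.Analysis"
begin

text \<open>
  A metric space is given as a subset \<open>X\<close> of an ambient metric space, with the induced metric.
  Its closed balls are the sets \<open>subspace_cball X x r\<close> with \<open>x \<in> X\<close>.
\<close>

definition subspace_cball :: "'a::metric_space set \<Rightarrow> 'a \<Rightarrow> real \<Rightarrow> 'a set" where
  "subspace_cball X x r = X \<inter> cball x r"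

text \<open>The centres of the covering balls lie in \<open>X\<close>; the value is \<open>\<infinity>\<close> if no finite cover exists.\<close>

definition covering_number :: "'a::metric_space set \<Rightarrow> real \<Rightarrow> 'a set \<Rightarrow> enat" where
  "covering_number X r E =
     (INF K \<in> {K. finite K \<and> K \<subseteq> X \<and> E \<subseteq> (\<Union>y\<in>K. subspace_cball X y r)}. enat (card K))"

text \<open>The supremum is taken in the extended reals, so that it is meaningful for every \<open>X\<close>.\<close>

definition monotone_lower_spectrum :: "real \<Rightarrow> 'a::metric_space set \<Rightarrow> ereal" where
  "monotone_lower_spectrum \<theta> X =
     Sup (ereal ` {s. 0 \<le> s \<and>
       (\<exists>C>0. \<forall>r R. 0 < r \<and> r \<le> r powr \<theta> \<and> r powr \<theta> \<le> R \<and> R < 1 \<longrightarrow>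
          ereal_of_enat (INF x\<in>X. covering_number X r (subspace_cball X x R))
            \<ge> ereal (C * (R / r) powr s))})"

text \<open>
  The quantity \<open>(1 - \<theta>) dim\<close>, with the convention that it is \<open>0\<close> for \<open>\<theta> = 1\<close>, where the
  spectrum itself is not considered.
\<close>

definition scaled_monotone_lower_spectrum :: "real \<Rightarrow> 'a::metric_space set \<Rightarrow> ereal" where
  "scaled_monotone_lower_spectrum \<theta> X =
     (if \<theta> = 1 then 0 else ereal (1 - \<theta>) * monotone_lower_spectrum \<theta> X)"

text \<open>
  Functions on \<open>(0,1]\<close> are represented by functions on the reals whose values outside \<open>(0,1]\<close>
  are irrelevant.
\<close>

definition spectrum_class :: "real \<Rightarrow> (real \<Rightarrow> real) set" where
  "spectrum_class \<alpha> = {\<phi>. \<phi> \<in> {0<..1} \<rightarrow> {0..\<alpha>} \<and>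
     (\<forall>l\<in>{0<..1}. \<forall>\<theta>\<in>{0<..1}. \<phi> (l * \<theta>) \<le> (1 - \<theta>) * \<alpha> + \<theta> * \<phi> l) \<and>
     antimono_on {0<..<1} (\<lambda>\<theta>. \<phi> \<theta> / (1 - \<theta>)) \<and>
     \<phi> 1 = 0}"

definition basic_fun :: "real \<Rightarrow> real \<Rightarrow> real \<Rightarrow> real \<Rightarrow> real" where
  "basic_fun \<alpha> l t \<theta> =
     (if \<theta> \<le> l then \<alpha> + \<theta> / l * (t - \<alpha>) else t * ((1 - \<theta>) / (1 - l)))"

end

theory Submission
  imports Defs
begin

text \<open>
  Write \<open>d\<close> for the dimension. Membership in \<open>spectrum_class d\<close> says that both
  \<open>(d - \<phi> x) / x\<close> and \<open>\<phi> x / (1 - x)\<close> are non-increasing. In the cross-multiplied form of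
  \<open>spectrum_class_iff\<close> these are inequalities preserved by infima, and the basic function with
  corner \<open>(l, t)\<close> is the largest function satisfying them whose value at \<open>l\<close> is \<open>t\<close>. So a
  function of the class is the infimum of the basic functions with corners on its graph, and
  conversely (\<open>spectrum_class_iff_Inf_basic_fun\<close>).

  The scaled spectrum of every non-empty set lies in the class
  (\<open>scaled_spectrum_in_spectrum_class\<close>). Enlarging \<open>\<theta>\<close> admits more pairs of scales, which gives
  the second monotonicity. For the first, a ball of radius \<open>\<rho>\<close> needs at most a constant times
  \<open>(\<rho> / r)^d\<close> balls of radius \<open>r < \<rho>\<close>; hence many balls at scale \<open>r = \<rho> powr (1 / \<theta>)\<close> force many
  balls at scale \<open>\<rho>\<close>, and \<open>r powr (l * \<theta>) = \<rho> powr l\<close>, so the constraint on the outer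
  radius is the same for both scales.

  For the converse, let \<open>\<psi> = \<phi> / d\<close>. It is enough to build a set \<open>T\<close> of reals whose scaled
  spectrum is \<open>\<psi>\<close> and to take \<open>T^d\<close>. For each pair of scales \<open>2^-n < 2^-m < 1\<close>, put \<open>l = m / n\<close>
  and \<open>s = \<psi> l / (1 - l)\<close>. Around the point \<open>10 j\<close>, \<open>j\<close> being the index of the pair, the line is
  punctured in an interval of radius comparable to \<open>2^-m\<close>, and the puncture is filled with a set
  of diameter at most \<open>2^-m\<close> that looks \<open>s\<close>-dimensional between the scales \<open>2^-m\<close> and \<open>2^-n\<close>
  and consists of intervals below \<open>2^-n\<close>: the numbers whose binary digits between these scales
  are free at positions of density \<open>s\<close> and vanish elsewhere. The ball of radius \<open>2^-m\<close> about \<open>10 j\<close>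
  needs only about \<open>2^(s (n - m)) = (2^n)^(\<psi> l)\<close> balls of radius \<open>2^-n\<close>. Letting
  \<open>n\<close> tend to infinity with \<open>m = \<lfloor>\<theta> n\<rfloor>\<close> bounds the spectrum from above.

  A piece does no further harm. A ball much larger than the piece contains an interval of
  comparable length outside of it, because the pieces are isolated; so the worst pairs of
  scales have outer radius at most about \<open>2^-m\<close>. On these the digit set is full enough exactly by the two
  inequalities of the class: the second one if \<open>l \<le> \<theta>\<close>, the first one if \<open>\<theta> < l\<close>
  (\<open>spectrum_exponent_bound\<close>). Thus the lower bound holds for all pieces with one constant.
\<close>

section \<open>The class of functions as infima of the basic functions\<close>

text \<open>
  After multiplying out the denominators both conditions are linear in the function and make sense
  up to the right end point, where they encode \<open>\<phi> x \<le> \<alpha> * (1 - x)\<close>; in this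
  form they pass to infima.
\<close>
lemma spectrum_class_iff:
  assumes "0 \<le> \<alpha>"
  shows "\<phi> \<in> spectrum_class \<alpha> \<longleftrightarrow> \<phi> \<in> {0<..1} \<rightarrow> {0..\<alpha>} \<and> \<phi> 1 = 0 \<and>
    (\<forall>x y. 0 < x \<longrightarrow> x \<le> y \<longrightarrow> y \<le> 1 \<longrightarrow>
       y * \<phi> x \<le> (y - x) * \<alpha> + x * \<phi> y \<and> (1 - x) * \<phi> y \<le> (1 - y) * \<phi> x)"
    (is "?L \<longleftrightarrow> ?R")
proof
  assume L: ?L
  then have range: "\<phi> \<in> {0<..1} \<rightarrow> {0..\<alpha>}" and one: "\<phi> 1 = 0"
    and mul: "\<And>l \<theta>. l \<in> {0<..1} \<Longrightarrow> \<theta> \<in> {0<..1} \<Longrightarrow> \<phi> (l * \<theta>) \<le> (1 - \<theta>) * \<alpha> + \<theta> * \<phi> l"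
    and anti: "antimono_on {0<..<1} (\<lambda>\<theta>. \<phi> \<theta> / (1 - \<theta>))"
    by (auto simp: spectrum_class_def)
  have "y * \<phi> x \<le> (y - x) * \<alpha> + x * \<phi> y \<and> (1 - x) * \<phi> y \<le> (1 - y) * \<phi> x"
    if xy: "0 < x" "x \<le> y" "y \<le> 1" for x y
  proof
    have "\<phi> x \<le> (1 - x / y) * \<alpha> + x / y * \<phi> y"
      using mul[of y "x / y"] xy by auto
    then show "y * \<phi> x \<le> (y - x) * \<alpha> + x * \<phi> y"
      using xy by (simp add: field_simps)
    show "(1 - x) * \<phi> y \<le> (1 - y) * \<phi> x"
    proof (cases "y = 1")
      case False
      then have "\<phi> y / (1 - y) \<le> \<phi> x / (1 - x)"
        using xy by (intro monotone_onD[OF anti]) auto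
      then show ?thesis using xy False by (simp add: field_simps)
    qed (use one in simp)
  qed
  then show ?R using range one by blast
next
  assume R: ?R
  have "\<phi> (l * \<theta>) \<le> (1 - \<theta>) * \<alpha> + \<theta> * \<phi> l" if "l \<in> {0<..1}" "\<theta> \<in> {0<..1}" for l \<theta>
  proof -
    have "l * \<phi> (l * \<theta>) \<le> (l - l * \<theta>) * \<alpha> + l * \<theta> * \<phi> l"
      using R that by (simp add: mult_left_le)
    also have "\<dots> = l * ((1 - \<theta>) * \<alpha> + \<theta> * \<phi> l)" by (simp add: algebra_simps)
    finally show ?thesis using that by simp
  qed
  moreover have "antimono_on {0<..<1} (\<lambda>\<theta>. \<phi> \<theta> / (1 - \<theta>))"
  proof (rule monotone_onI)
    fix x y :: real assume "x \<in> {0<..<1}" "y \<in> {0<..<1}" "x \<le> y"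
    moreover from this have "(1 - x) * \<phi> y \<le> (1 - y) * \<phi> x" using R by auto
    ultimately show "\<phi> y / (1 - y) \<le> \<phi> x / (1 - x)" by (simp add: field_simps)
  qed
  ultimately show ?L using R by (auto simp: spectrum_class_def)
qed

lemma spectrum_classD:
  assumes "0 \<le> \<alpha>" "\<phi> \<in> spectrum_class \<alpha>"
  shows "0 < x \<Longrightarrow> x \<le> y \<Longrightarrow> y \<le> 1 \<Longrightarrow> y * \<phi> x \<le> (y - x) * \<alpha> + x * \<phi> y"
    and "0 < x \<Longrightarrow> x \<le> y \<Longrightarrow> y \<le> 1 \<Longrightarrow> (1 - x) * \<phi> y \<le> (1 - y) * \<phi> x"
    and "\<phi> 1 = 0"
    and "0 < x \<Longrightarrow> x \<le> 1 \<Longrightarrow> 0 \<le> \<phi> x"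
  using assms(2)[unfolded spectrum_class_iff[OF assms(1)]] by (blast, blast, blast, auto)

text \<open>
  A basic function is the maximum of two lines, one through \<open>(0, \<alpha>)\<close> and one through \<open>(1, 0)\<close>,
  that meet over \<open>l\<close>. The slopes are recorded without division, so that \<open>l = 1\<close>, where
  \<open>t / (1 - l)\<close> is \<open>0\<close>, needs no separate treatment later.
\<close>
lemma basic_fun_two_lines:
  assumes "0 \<le> \<alpha>" "0 < l" "l \<le> 1" "0 \<le> t" "t \<le> \<alpha> * (1 - l)"
  obtains k w where "0 \<le> w" "w \<le> \<alpha>" "\<alpha> \<le> k" "k * l + w * (1 - l) = \<alpha>"
    and "\<And>x. basic_fun \<alpha> l t x = (if x \<le> l then \<alpha> - k * x else w * (1 - x))"
proof (rule that[of "t / (1 - l)" "(\<alpha> - t) / l"])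
  show "0 \<le> t / (1 - l)" using assms by simp
  show "t / (1 - l) \<le> \<alpha>"
    using assms by (cases "l = 1") (simp_all add: pos_divide_le_eq)
  show "\<alpha> \<le> (\<alpha> - t) / l" using assms by (simp add: pos_le_divide_eq algebra_simps)
  show "(\<alpha> - t) / l * l + t / (1 - l) * (1 - l) = \<alpha>"
    using assms by (cases "l = 1") simp_all
  show "basic_fun \<alpha> l t x = (if x \<le> l then \<alpha> - (\<alpha> - t) / l * x else t / (1 - l) * (1 - x))" for x
    using assms by (simp add: basic_fun_def diff_divide_distrib algebra_simps)
qed

lemma basic_fun_nonneg:
  assumes "0 \<le> \<alpha>" "0 < l" "l \<le> 1" "0 \<le> t" "t \<le> \<alpha> * (1 - l)" "x \<le> 1"
  shows "0 \<le> basic_fun \<alpha> l t x"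
proof -
  obtain k w where kw: "0 \<le> w" "w \<le> \<alpha>" "\<alpha> \<le> k" "k * l + w * (1 - l) = \<alpha>"
    and eq: "\<And>x. basic_fun \<alpha> l t x = (if x \<le> l then \<alpha> - k * x else w * (1 - x))"
    by (rule basic_fun_two_lines[OF assms(1-5)], rule that)
  have "k * x \<le> k * l" if "x \<le> l" using that kw by (intro mult_left_mono) auto
  moreover have "0 \<le> w * (1 - l)" "0 \<le> w * (1 - x)" using kw assms by auto
  ultimately show ?thesis using kw by (auto simp: eq)
qed

lemma basic_fun_inequalities:
  assumes "0 \<le> \<alpha>" "0 < l" "l \<le> 1" "0 \<le> t" "t \<le> \<alpha> * (1 - l)"
    and xy: "0 < x" "x \<le> y" "y \<le> 1"
  defines "f \<equiv> basic_fun \<alpha> l t"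
  shows "y * f x \<le> (y - x) * \<alpha> + x * f y" (is ?A)
    and "(1 - x) * f y \<le> (1 - y) * f x" (is ?B)
proof -
  obtain k w where kw: "0 \<le> w" "w \<le> \<alpha>" "\<alpha> \<le> k" "k * l + w * (1 - l) = \<alpha>"
    and basic: "\<And>x. basic_fun \<alpha> l t x = (if x \<le> l then \<alpha> - k * x else w * (1 - x))"
    by (rule basic_fun_two_lines[OF assms(1-5)], rule that)
  have eq: "f x = (if x \<le> l then \<alpha> - k * x else w * (1 - x))" for x
    unfolding f_def by (rule basic)
  consider "y \<le> l" | "x \<le> l" "l < y" | "l < x" by linarith
  then have "?A \<and> ?B"
  proof cases
    case 1
    have "\<alpha> * (y - x) \<le> k * (y - x)" using kw xy by (intro mult_right_mono) auto
    then show ?thesis using 1 xy by (simp add: eq algebra_simps)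
  next
    case 2
    have "0 \<le> x * ((k - w) * (y - l))" using kw xy 2 by simp
    moreover have "0 \<le> (1 - y) * ((k - w) * (l - x))" using kw xy 2 by simp
    moreover have "\<alpha> * z = (k * l + w * (1 - l)) * z" for z using kw by simp
    note this[of 1] this[of x] this[of y]
    ultimately show ?thesis using 2 by (simp add: eq algebra_simps)
  next
    case 3
    have "w * (y - x) \<le> \<alpha> * (y - x)" using kw xy by (intro mult_right_mono) auto
    then show ?thesis using 3 xy by (simp add: eq algebra_simps)
  qed
  then show ?A ?B by auto
qed

text \<open>
  The first inequality, between \<open>x\<close> and \<open>l\<close>, gives the bound to the left of the corner;
  the second one gives it to the right.
\<close>
lemma spectrum_class_le_basic_fun:
  assumes "0 \<le> \<alpha>" "\<phi> \<in> spectrum_class \<alpha>" "0 < l" "l \<le> 1" "0 < x" "x \<le> 1"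
  shows "\<phi> x \<le> basic_fun \<alpha> l (\<phi> l) x"
proof (cases "x \<le> l")
  case True
  then have "l * \<phi> x \<le> (l - x) * \<alpha> + x * \<phi> l"
    using spectrum_classD(1)[OF assms(1,2)] assms(3-6) by simp
  then have "\<phi> x \<le> ((l - x) * \<alpha> + x * \<phi> l) / l"
    using assms by (simp add: pos_le_divide_eq mult.commute)
  also have "\<dots> = basic_fun \<alpha> l (\<phi> l) x"
    using True assms by (simp add: basic_fun_def divide_simps) (simp add: algebra_simps)
  finally show ?thesis .
next
  case False
  then have "(1 - l) * \<phi> x \<le> (1 - x) * \<phi> l"
    using spectrum_classD(2)[OF assms(1,2), of l x] assms(3-6) by simp
  then show ?thesis using False assms by (simp add: basic_fun_def pos_le_divide_eq mult.commute)
qed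

lemma spectrum_class_le_linear:
  assumes "0 \<le> \<alpha>" "\<phi> \<in> spectrum_class \<alpha>" "0 < l" "l \<le> 1"
  shows "\<phi> l \<le> \<alpha> * (1 - l)"
  using spectrum_classD(1)[OF assms(1,2), of l 1] spectrum_classD(3)[OF assms(1,2)] assms(3,4)
  by (simp add: algebra_simps)

text \<open>
  A function of the class is the minimum over all corners \<open>(l, \<phi> l)\<close> of its own graph. Conversely
  each of the two inequalities has the form \<open>c * \<phi> x \<le> e + c' * \<phi> y\<close> with non-negative \<open>c\<close> and \<open>c'\<close>: on
  the left bound the infimum by a member of the family, then take the infimum on the right.
\<close>
theorem spectrum_class_iff_Inf_basic_fun:
  assumes \<alpha>: "0 \<le> \<alpha>" and range: "\<phi> \<in> {0<..1} \<rightarrow> {0..\<alpha>}"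
  shows "\<phi> \<in> spectrum_class \<alpha> \<longleftrightarrow>
    (\<exists>P. P \<noteq> {} \<and> P \<subseteq> {(l, t). 0 < l \<and> l \<le> 1 \<and> 0 \<le> t \<and> t \<le> \<alpha> * (1 - l)} \<and>
         (\<forall>\<theta>\<in>{0<..1}. \<phi> \<theta> = (INF (l, t)\<in>P. basic_fun \<alpha> l t \<theta>)))"
    (is "_ \<longleftrightarrow> (\<exists>P. P \<noteq> {} \<and> P \<subseteq> ?par \<and> ?inf P)")
proof
  assume \<phi>: "\<phi> \<in> spectrum_class \<alpha>"
  define P where "P = (\<lambda>l. (l, \<phi> l)) ` {0<..1}"
  have "P \<subseteq> ?par"
    using spectrum_class_le_linear[OF \<alpha> \<phi>] spectrum_classD(4)[OF \<alpha> \<phi>] by (auto simp: P_def)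
  moreover have "P \<noteq> {}" by (auto simp: P_def)
  moreover have "\<phi> \<theta> = (INF (l, t)\<in>P. basic_fun \<alpha> l t \<theta>)" if \<theta>: "\<theta> \<in> {0<..1}" for \<theta>
  proof (rule cInf_eq_minimum[symmetric])
    have "basic_fun \<alpha> \<theta> (\<phi> \<theta>) \<theta> = \<phi> \<theta>" using \<theta> by (simp add: basic_fun_def)
    then show "\<phi> \<theta> \<in> (\<lambda>(l, t). basic_fun \<alpha> l t \<theta>) ` P"
      using \<theta> unfolding P_def image_image by (intro image_eqI[of _ _ \<theta>]) auto
  qed (use spectrum_class_le_basic_fun[OF \<alpha> \<phi>] \<theta> in \<open>auto simp: P_def\<close>)
  ultimately show "\<exists>P. P \<noteq> {} \<and> P \<subseteq> ?par \<and> ?inf P" by blast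
next
  assume "\<exists>P. P \<noteq> {} \<and> P \<subseteq> ?par \<and> ?inf P"
  then obtain P where P: "P \<noteq> {}" "P \<subseteq> ?par" and "?inf P" by blast
  then have inf: "\<phi> \<theta> = (INF (l, t)\<in>P. basic_fun \<alpha> l t \<theta>)" if "0 < \<theta>" "\<theta> \<le> 1" for \<theta>
    using that by (metis greaterThanAtMost_iff)
  obtain l\<^sub>0 t\<^sub>0 where lt0: "(l\<^sub>0, t\<^sub>0) \<in> P" using P(1) by (metis ex_in_conv surj_pair)
  have le: "\<phi> \<theta> \<le> basic_fun \<alpha> l t \<theta>" if "(l, t) \<in> P" "0 < \<theta>" "\<theta> \<le> 1" for l t \<theta>
  proof -
    have "bdd_below ((\<lambda>(l, t). basic_fun \<alpha> l t \<theta>) ` P)"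
      using P(2) that \<alpha> by (intro bdd_belowI[of _ 0]) (auto intro!: basic_fun_nonneg)
    then have "(INF (l, t)\<in>P. basic_fun \<alpha> l t \<theta>) \<le> (\<lambda>(l, t). basic_fun \<alpha> l t \<theta>) (l, t)"
      using that(1) by (rule cINF_lower)
    then show ?thesis using inf[of \<theta>] that by simp
  qed
  have greatest: "c \<le> \<phi> \<theta>" if "\<And>l t. (l, t) \<in> P \<Longrightarrow> c \<le> basic_fun \<alpha> l t \<theta>" "0 < \<theta>" "\<theta> \<le> 1"
    for c \<theta>
    unfolding inf[OF that(2,3)] using that(1) P(1) by (intro cINF_greatest) auto
  have one: "\<phi> 1 = 0"
  proof -
    have "basic_fun \<alpha> l\<^sub>0 t\<^sub>0 1 \<le> 0" using lt0 P(2) by (auto simp: basic_fun_def)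
    then have "\<phi> 1 \<le> 0" using le[OF lt0, of 1] by simp
    moreover have "0 \<le> \<phi> 1" using range by (auto simp: Pi_iff)
    ultimately show ?thesis by simp
  qed
  have "y * \<phi> x \<le> (y - x) * \<alpha> + x * \<phi> y \<and> (1 - x) * \<phi> y \<le> (1 - y) * \<phi> x"
    if xy: "0 < x" "x \<le> y" "y \<le> 1" for x y
  proof
    have "(y * \<phi> x - (y - x) * \<alpha>) / x \<le> \<phi> y"
    proof (rule greatest)
      fix l t assume lt: "(l, t) \<in> P"
      have "y * \<phi> x \<le> y * basic_fun \<alpha> l t x"
        using le[OF lt, of x] xy by (intro mult_left_mono) auto
      also have "\<dots> \<le> (y - x) * \<alpha> + x * basic_fun \<alpha> l t y"
        using lt P(2) xy \<alpha> by (intro basic_fun_inequalities) auto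
      finally show "(y * \<phi> x - (y - x) * \<alpha>) / x \<le> basic_fun \<alpha> l t y"
        using xy by (simp add: pos_divide_le_eq algebra_simps)
    qed (use xy in auto)
    then show "y * \<phi> x \<le> (y - x) * \<alpha> + x * \<phi> y" using xy by (simp add: pos_divide_le_eq algebra_simps)
    show "(1 - x) * \<phi> y \<le> (1 - y) * \<phi> x"
    proof (cases "y = 1")
      case True
      then show ?thesis using one by simp
    next
      case False
      have "(1 - x) * \<phi> y / (1 - y) \<le> \<phi> x"
      proof (rule greatest)
        fix l t assume lt: "(l, t) \<in> P"
        have "(1 - x) * \<phi> y \<le> (1 - x) * basic_fun \<alpha> l t y"
          using le[OF lt, of y] xy by (intro mult_left_mono) auto
        also have "\<dots> \<le> (1 - y) * basic_fun \<alpha> l t x"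
          using lt P(2) xy \<alpha> by (intro basic_fun_inequalities) auto
        finally show "(1 - x) * \<phi> y / (1 - y) \<le> basic_fun \<alpha> l t x"
          using xy False by (simp add: pos_divide_le_eq mult.commute)
      qed (use xy in auto)
      then show ?thesis using xy False by (simp add: pos_divide_le_eq mult.commute)
    qed
  qed
  then show "\<phi> \<in> spectrum_class \<alpha>"
    unfolding spectrum_class_iff[OF \<alpha>] using range one by blast
qed

section \<open>Finite covers and the necessity of the two inequalities\<close>

text \<open>
  An infimum of extended naturals is attained unless the set is empty; so lower bounds for
  it can be tested on the members, in spite of the passage to the extended reals.
\<close>
lemma le_ereal_of_enat_Inf_iff:
  "ereal v \<le> ereal_of_enat (Inf A) \<longleftrightarrow> (\<forall>a\<in>A. ereal v \<le> ereal_of_enat a)"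
proof (cases "A = {}")
  case False
  then have "Inf A \<in> A" unfolding Inf_enat_def by (auto intro: LeastI)
  moreover have "ereal_of_enat (Inf A) \<le> ereal_of_enat a" if "a \<in> A" for a
    using that by (simp add: Inf_lower)
  ultimately show ?thesis using order_trans by blast
qed (simp add: Inf_enat_def)

definition finite_cover :: "'a::metric_space set \<Rightarrow> real \<Rightarrow> 'a set \<Rightarrow> 'a set \<Rightarrow> bool" where
  "finite_cover X r E K \<longleftrightarrow> finite K \<and> K \<subseteq> X \<and> E \<subseteq> (\<Union>y\<in>K. cball y r)"

lemma le_covering_number_iff:
  assumes "E \<subseteq> X"
  shows "ereal v \<le> ereal_of_enat (covering_number X r E) \<longleftrightarrow>
    (\<forall>K. finite_cover X r E K \<longrightarrow> v \<le> real (card K))"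
proof -
  have "E \<subseteq> (\<Union>y\<in>K. subspace_cball X y r) \<longleftrightarrow> E \<subseteq> (\<Union>y\<in>K. cball y r)" for K
    using assms by (auto simp: subspace_cball_def)
  then show ?thesis
    by (simp add: covering_number_def le_ereal_of_enat_Inf_iff finite_cover_def)
qed

text \<open>
  The exponents in the supremum that defines the spectrum, with covering numbers
  replaced by the cardinalities of finite covers, which avoids extended arithmetic.
\<close>
definition lower_exponent :: "real \<Rightarrow> 'a::metric_space set \<Rightarrow> real \<Rightarrow> bool" where
  "lower_exponent \<theta> X s \<longleftrightarrow> 0 \<le> s \<and>
     (\<exists>C>0. \<forall>r R x K. 0 < r \<longrightarrow> r \<le> r powr \<theta> \<longrightarrow> r powr \<theta> \<le> R \<longrightarrow> R < 1 \<longrightarrow> x \<in> X \<longrightarrow>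
        finite_cover X r (X \<inter> cball x R) K \<longrightarrow> C * (R / r) powr s \<le> real (card K))"

lemma monotone_lower_spectrum_eq:
  "monotone_lower_spectrum \<theta> X = Sup (ereal ` {s. lower_exponent \<theta> X s})"
proof -
  have "ereal v \<le> ereal_of_enat (INF x\<in>X. covering_number X r (subspace_cball X x R)) \<longleftrightarrow>
    (\<forall>x\<in>X. \<forall>K. finite_cover X r (X \<inter> cball x R) K \<longrightarrow> v \<le> real (card K))" for v r R
    by (simp add: le_ereal_of_enat_Inf_iff le_covering_number_iff subspace_cball_def)
  then show ?thesis
    unfolding monotone_lower_spectrum_def lower_exponent_def
    by (intro arg_cong[where f = Sup] arg_cong[where f = "image ereal"]) auto
qed

lemma lower_exponent_mono:
  assumes "lower_exponent \<theta> X s" "\<theta>' \<le> \<theta>" "\<theta> \<le> 1"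
  shows "lower_exponent \<theta>' X s"
proof -
  obtain C where "0 \<le> s" "0 < C" and C: "\<And>r R x K. 0 < r \<Longrightarrow> r \<le> r powr \<theta> \<Longrightarrow>
      r powr \<theta> \<le> R \<Longrightarrow> R < 1 \<Longrightarrow> x \<in> X \<Longrightarrow> finite_cover X r (X \<inter> cball x R) K \<Longrightarrow>
      C * (R / r) powr s \<le> real (card K)"
    using assms(1) unfolding lower_exponent_def by blast
  have "r \<le> r powr \<theta> \<and> r powr \<theta> \<le> R" 
    if "0 < r" "r \<le> r powr \<theta>'" "r powr \<theta>' \<le> R" "R < 1" for r R
  proof -
    have "r \<le> 1" using that by linarith
    then have "r powr 1 \<le> r powr \<theta>" "r powr \<theta> \<le> r powr \<theta>'"
      using that(1) assms(2,3) by (intro powr_mono'; simp)+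
    moreover have "r powr 1 = r" using that(1) by simp
    ultimately show ?thesis using that by linarith
  qed
  then show ?thesis using \<open>0 \<le> s\<close> \<open>0 < C\<close> C unfolding lower_exponent_def by blast
qed

lemma finite_cover_trans:
  fixes X :: "'a::metric_space set"
  assumes "finite_cover X \<rho> E K"
    and "\<And>y. y \<in> K \<Longrightarrow> \<exists>L. finite_cover X r (X \<inter> cball y \<rho>) L \<and> real (card L) \<le> c"
    and "E \<subseteq> X"
  obtains L where "finite_cover X r E L" "real (card L) \<le> real (card K) * c"
proof -
  obtain L where L: "\<And>y. y \<in> K \<Longrightarrow> finite_cover X r (X \<inter> cball y \<rho>) (L y)"
    "\<And>y. y \<in> K \<Longrightarrow> real (card (L y)) \<le> c"
    using assms(2) by metis
  have K: "finite K" using assms(1) by (simp add: finite_cover_def)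
  have cov: "finite_cover X r E (\<Union>y\<in>K. L y)"
    unfolding finite_cover_def
  proof (intro conjI subsetI)
    fix z assume "z \<in> E"
    moreover have "E \<subseteq> (\<Union>y\<in>K. cball y \<rho>)" using assms(1) by (simp add: finite_cover_def)
    ultimately obtain y where y: "y \<in> K" "z \<in> X \<inter> cball y \<rho>" using assms(3) by blast
    moreover have "X \<inter> cball y \<rho> \<subseteq> (\<Union>w\<in>L y. cball w r)"
      using L(1)[OF y(1)] by (simp add: finite_cover_def)
    ultimately show "z \<in> (\<Union>w\<in>\<Union>y\<in>K. L y. cball w r)" by blast
  qed (use L K in \<open>auto simp: finite_cover_def\<close>)
  have "real (card (\<Union>y\<in>K. L y)) \<le> real (\<Sum>y\<in>K. card (L y))"
    using card_UN_le[OF K] by (rule of_nat_mono)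
  also have "\<dots> \<le> real (card K) * c"
    using sum_bounded_above[of K "\<lambda>y. real (card (L y))" c] L(2) by simp
  finally show ?thesis using cov that by blast
qed

text \<open>
  Subdivide space into cubes of side \<open>r / d\<close>. Two points of one cube are at most \<open>r\<close> apart,
  because the norm is at most the sum of the coordinates, so one point of the set from each cube
  that it meets will do. Selecting the centres among the points of the set is what the definition
  of the covering number asks for.
\<close>
lemma grid_cover:
  fixes X :: "(real ^ 'n) set"
  assumes "0 < r" "r \<le> \<rho>"
  obtains L where "finite_cover X r (X \<inter> cball y \<rho>) L"
    "real (card L) \<le> (2 * real CARD('n) + 2) ^ CARD('n) * (\<rho> / r) ^ CARD('n)"
proof -
  define d where "d = real CARD('n)"
  have d: "1 \<le> d" by (simp add: d_def Suc_le_eq)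
  define u where "u = d / r"
  have u: "0 < u" using d assms by (simp add: u_def)
  define cell where "cell x = (\<lambda>i. \<lfloor>(x $ i - y $ i) * u\<rfloor>)" for x :: "real ^ 'n"
  define E where "E = X \<inter> cball y \<rho>"
  define I where "I = {\<lfloor>- (\<rho> * u)\<rfloor>..\<lfloor>\<rho> * u\<rfloor>}"
  have "cell x i \<in> I" if "x \<in> E" for x i
  proof -
    have "norm (x - y) \<le> \<rho>" using that by (simp add: E_def dist_norm norm_minus_commute)
    then have "\<bar>x $ i - y $ i\<bar> \<le> \<rho>"
      using component_le_norm_cart[of "x - y" i] by simp
    then have "\<bar>(x $ i - y $ i) * u\<bar> \<le> \<rho> * u"
      using u by (simp add: abs_mult)
    then show ?thesis by (auto simp: I_def cell_def abs_le_iff intro!: floor_mono)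
  qed
  then have sub: "cell ` E \<subseteq> (UNIV \<rightarrow>\<^sub>E I)" by auto
  have fin: "finite (UNIV \<rightarrow>\<^sub>E I :: ('n \<Rightarrow> int) set)" by (rule finite_PiE) (auto simp: I_def)
  have fin_cells: "finite (cell ` E)" using sub fin by (rule finite_subset)
  have card: "card (cell ` E) \<le> card I ^ CARD('n)"
    using card_mono[OF fin sub] by (simp add: card_PiE)
  define g where "g = (\<lambda>c. SOME x. x \<in> E \<and> cell x = c)"
  have g: "g (cell x) \<in> E \<and> cell (g (cell x)) = cell x" if "x \<in> E" for x
    unfolding g_def by (rule someI[of _ x]) (use that in auto)
  have "finite_cover X r E (g ` cell ` E)"
    unfolding finite_cover_def
  proof (intro conjI subsetI)
    fix x assume "x \<in> E"
    define z where "z = g (cell x)"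
    have "\<bar>(z - x) $ i\<bar> \<le> r / d" for i
    proof -
      have "\<lfloor>(z $ i - y $ i) * u\<rfloor> = \<lfloor>(x $ i - y $ i) * u\<rfloor>"
        using g[OF \<open>x \<in> E\<close>] by (simp add: z_def cell_def fun_eq_iff)
      then have "\<bar>(z $ i - y $ i) * u - (x $ i - y $ i) * u\<bar> \<le> 1" by linarith
      moreover have "(z $ i - y $ i) * u - (x $ i - y $ i) * u = (z - x) $ i * u"
        by (simp add: algebra_simps)
      ultimately have "\<bar>(z - x) $ i\<bar> * u \<le> 1" using u by (simp add: abs_mult)
      then have "\<bar>(z - x) $ i\<bar> \<le> 1 / u" using u by (simp add: pos_le_divide_eq)
      then show ?thesis by (simp add: u_def)
    qed
    then have "norm (z - x) \<le> (\<Sum>i\<in>(UNIV::'n set). r / d)"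
      by (intro order_trans[OF norm_le_l1_cart] sum_mono) simp
    also have "\<dots> = r" by (simp add: d_def)
    finally have "x \<in> cball z r" by (simp add: dist_norm)
    then show "x \<in> (\<Union>y\<in>g ` cell ` E. cball y r)" using \<open>x \<in> E\<close> by (auto simp: z_def)
  qed (use g fin_cells in \<open>auto simp: E_def\<close>)
  moreover have "real (card (g ` cell ` E)) \<le> (2 * real CARD('n) + 2) ^ CARD('n) * (\<rho> / r) ^ CARD('n)"
  proof -
    have "real (card (g ` cell ` E)) \<le> real (card I ^ CARD('n))"
      using card card_image_le[OF fin_cells, of g] by (intro of_nat_mono) simp
    also have "\<dots> = real (card I) ^ CARD('n)" by simp
    also have "\<dots> \<le> ((2 * d + 2) * (\<rho> / r)) ^ CARD('n)"
    proof (rule power_mono)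
      have "0 \<le> \<rho> * u" using assms u by simp
      then have "real (card I) \<le> 2 * (\<rho> * u) + 2" unfolding I_def by simp linarith
      moreover have "1 \<le> \<rho> / r" using assms by simp
      moreover have "(2 * d + 2) * (\<rho> / r) = 2 * (\<rho> * u) + 2 * (\<rho> / r)"
        by (simp add: u_def algebra_simps)
      ultimately show "real (card I) \<le> (2 * d + 2) * (\<rho> / r)" by linarith
    qed simp
    finally show ?thesis by (simp only: power_mult_distrib d_def)
  qed
  ultimately show ?thesis using that unfolding E_def by blast
qed

lemma slope_le_if_linear_growth_le:
  fixes a b c :: real
  assumes "\<And>n::nat. N \<le> n \<Longrightarrow> a * real n \<le> b * real n + c"
  shows "a \<le> b"
proof (rule ccontr)
  assume "\<not> a \<le> b"
  then have ab: "0 < a - b" by simp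
  obtain m :: nat where m: "c / (a - b) < real m" using reals_Archimedean2 by blast
  define n where "n = max m N"
  have "c / (a - b) < real n" using m by (simp add: n_def)
  then have "c < (a - b) * real n" using ab by (simp add: pos_divide_less_eq mult.commute)
  moreover have "a * real n \<le> b * real n + c" using assms by (simp add: n_def)
  ultimately show False by (simp add: algebra_simps)
qed

text \<open>
  Fix the outer radius \<open>1 / 2\<close> and let the inner radius be \<open>2^-n\<close>: the grid cover bounds the
  growth in \<open>n\<close> by that of \<open>2^(d n)\<close>.
\<close>
lemma lower_exponent_le_dim:
  fixes X :: "(real ^ 'n) set"
  assumes "lower_exponent \<theta> X s" "X \<noteq> {}" "0 < \<theta>" "\<theta> \<le> 1"
  shows "s \<le> real CARD('n)"
proof -
  define d where "d = CARD('n)"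
  define K where "K = (2 * real CARD('n) + 2) ^ CARD('n)"
  have K: "0 < K" unfolding K_def by (intro zero_less_power) simp
  obtain C where "0 < C" and C: "\<And>r R x L. 0 < r \<Longrightarrow> r \<le> r powr \<theta> \<Longrightarrow>
      r powr \<theta> \<le> R \<Longrightarrow> R < 1 \<Longrightarrow> x \<in> X \<Longrightarrow> finite_cover X r (X \<inter> cball x R) L \<Longrightarrow>
      C * (R / r) powr s \<le> real (card L)"
    using assms(1) unfolding lower_exponent_def by blast
  obtain x where x: "x \<in> X" using assms(2) by blast
  show ?thesis unfolding d_def[symmetric]
  proof (rule slope_le_if_linear_growth_le)
    fix n :: nat assume n: "max 1 (nat \<lceil>1 / \<theta>\<rceil>) \<le> n"
    define r :: real where "r = 2 powr - real n"
    have "1 \<le> \<theta> * real n"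
    proof -
      have "1 / \<theta> \<le> real n" using n by linarith
      then show ?thesis using assms(3) by (simp add: pos_divide_le_eq mult.commute)
    qed
    have r: "0 < r" "r \<le> 1" "r \<le> 1 / 2" "r \<le> r powr \<theta>" "r powr \<theta> \<le> 1 / 2"
    proof -
      show "0 < r" by (simp add: r_def)
      have "r \<le> 2 powr - 1" unfolding r_def using n by (intro powr_mono) auto
      then show "r \<le> 1 / 2" by (simp add: powr_minus)
      then show "r \<le> 1" by simp
      have "r powr 1 \<le> r powr \<theta>"
        using \<open>0 < r\<close> \<open>r \<le> 1\<close> assms(4) by (intro powr_mono') auto
      then show "r \<le> r powr \<theta>" using \<open>0 < r\<close> by simp
      have "r powr \<theta> = 2 powr - (\<theta> * n)" by (simp add: r_def powr_powr mult.commute)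
      also have "\<dots> \<le> 2 powr - 1" using \<open>1 \<le> \<theta> * real n\<close> by (intro powr_mono) auto
      finally show "r powr \<theta> \<le> 1 / 2" by (simp add: powr_minus)
    qed
    obtain L where L: "finite_cover X r (X \<inter> cball x (1 / 2)) L"
      "real (card L) \<le> K * ((1 / 2) / r) ^ d"
      using grid_cover[OF r(1,3), of X x] unfolding K_def d_def by metis
    have ratio: "(1 / 2) / r = 2 powr (real n - 1)" by (simp add: r_def powr_diff powr_minus field_simps)
    have "C * ((1 / 2) / r) powr s \<le> K * ((1 / 2) / r) ^ d"
      using C[OF r(1,4,5) _ x L(1)] L(2) by simp
    then have "C * 2 powr ((real n - 1) * s) \<le> K * 2 powr ((real n - 1) * d)"
      unfolding ratio by (simp add: powr_powr flip: powr_realpow)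
    then have "log 2 (C * 2 powr ((real n - 1) * s)) \<le> log 2 (K * 2 powr ((real n - 1) * d))"
      using \<open>0 < C\<close> K by (subst log_le_cancel_iff) auto
    then have "log 2 C + (real n - 1) * s \<le> log 2 K + (real n - 1) * d"
      using \<open>0 < C\<close> K by (simp add: log_mult)
    then show "s * real n \<le> real d * real n + (s + log 2 K - log 2 C - d)"
      by (simp add: algebra_simps)
  qed
qed

text \<open>
  With \<open>r = \<rho> powr (1 / \<theta>)\<close>, a cover at scale \<open>\<rho>\<close> is refined to one at scale \<open>r\<close> at the cost of
  a factor \<open>K * (\<rho> / r)^d\<close>, so a lower bound at scale \<open>r\<close> descends to scale \<open>\<rho>\<close>. The exponent
  \<open>u\<close> is the one obtained for the smallest admitted outer radius \<open>R = \<rho> powr l\<close>; for larger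
  \<open>R\<close> the bound is only better, because \<open>s \<le> d\<close>.
\<close>
lemma lower_exponent_rescale:
  fixes X :: "(real ^ 'n) set"
  assumes exponent: "lower_exponent (l * \<theta>) X s" and "X \<noteq> {}"
    and l: "0 < l" "l < 1" and \<theta>: "0 < \<theta>" "\<theta> < 1"
  defines "u \<equiv> (s * (1 - l * \<theta>) - (1 - \<theta>) * real CARD('n)) / (\<theta> * (1 - l))"
  assumes "0 \<le> u"
  shows "lower_exponent l X u"
proof -
  define K where "K = (2 * real CARD('n) + 2) ^ CARD('n)"
  have K: "0 < K" unfolding K_def by (intro zero_less_power) simp
  have sd: "s \<le> real CARD('n)" using lower_exponent_le_dim[OF exponent \<open>X \<noteq> {}\<close>] l \<theta> by (simp add: mult_le_one)
  obtain C where "0 < C" and C: "\<And>r R x L. 0 < r \<Longrightarrow> r \<le> r powr (l * \<theta>) \<Longrightarrow>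
      r powr (l * \<theta>) \<le> R \<Longrightarrow> R < 1 \<Longrightarrow> x \<in> X \<Longrightarrow> finite_cover X r (X \<inter> cball x R) L \<Longrightarrow>
      C * (R / r) powr s \<le> real (card L)"
    using exponent unfolding lower_exponent_def by blast
  have "C / K * (R / \<rho>) powr u \<le> real (card L)"
    if \<rho>: "0 < \<rho>" "\<rho> \<le> \<rho> powr l" "\<rho> powr l \<le> R" "R < 1" and x: "x \<in> X"
      and L: "finite_cover X \<rho> (X \<inter> cball x R) L" for \<rho> R x L
  proof -
    \<comment> \<open>In logarithmic coordinates the comparison of powers becomes bilinear.\<close>
    define a b where "a = - ln \<rho>" and "b = - ln R"
    have R: "0 < R" using \<rho> by (smt (verit) powr_gt_zero)
    have \<rho>a: "\<rho> = exp (- a)" and Rb: "R = exp (- b)" using \<rho> R by (auto simp: a_def b_def)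
    have b: "0 < b" "b \<le> l * a"
    proof -
      show "0 < b" using \<rho>(4) by (simp add: Rb)
      have "exp (- (l * a)) \<le> exp (- b)" using \<rho>(3) by (simp add: \<rho>a Rb powr_def)
      then show "b \<le> l * a" by simp
    qed
    then have a: "0 < a" using l by (smt (verit) mult_nonneg_nonpos)
    define r where "r = exp (- (a / \<theta>))"
    have "a \<le> a / \<theta>" using a \<theta> by (simp add: pos_le_divide_eq mult_left_le)
    then have r: "0 < r" "r \<le> \<rho>" by (auto simp: r_def \<rho>a)
    have rl: "r powr (l * \<theta>) = \<rho> powr l" using \<theta> by (simp add: r_def \<rho>a powr_def)
    have "\<exists>M. finite_cover X r (X \<inter> cball y \<rho>) M \<and> real (card M) \<le> K * (\<rho> / r) ^ CARD('n)" for y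
      using grid_cover[OF r] unfolding K_def by metis
    then obtain M where M: "finite_cover X r (X \<inter> cball x R) M"
      "real (card M) \<le> real (card L) * (K * (\<rho> / r) ^ CARD('n))"
      using finite_cover_trans[OF L] by blast
    have "r \<le> r powr (l * \<theta>)" using r \<rho> rl by linarith
    then have "C * (R / r) powr s \<le> real (card M)"
      using C[OF r(1) _ _ \<rho>(4) x M(1)] rl \<rho> by simp
    also have "\<dots> \<le> real (card L) * (K * (\<rho> / r) ^ CARD('n))" by (rule M(2))
    finally have main: "C * (R / r) powr s \<le> real (card L) * K * (\<rho> / r) powr CARD('n)"
      using r \<rho> by (simp add: powr_realpow)
    have "(R / \<rho>) powr u * (\<rho> / r) powr CARD('n) \<le> (R / r) powr s"
    proof -
      have "(a - b) * u + (a / \<theta> - a) * CARD('n) \<le> (a / \<theta> - b) * s"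
      proof -
        define v where "v = u * (\<theta> * (1 - l))"
        have v: "v = s * (1 - l * \<theta>) - (1 - \<theta>) * real CARD('n)"
          unfolding v_def u_def using l \<theta> by simp
        \<comment> \<open>After clearing denominators, this is the difference of the two sides.\<close>
        have "0 \<le> (1 - \<theta>) * ((real CARD('n) - s) * (l * a - b))"
          using sd b \<theta> by simp
        then have "(a - b) * v + a * (1 - \<theta>) * (1 - l) * CARD('n) \<le> (a - b * \<theta>) * (1 - l) * s"
          unfolding v by (simp add: algebra_simps)
        moreover define c where "c = a / \<theta>"
        then have c: "a / \<theta> = c" "a = c * \<theta>" using \<theta> by auto
        ultimately have "((a - b) * u + (c - a) * CARD('n)) * (\<theta> * (1 - l)) \<le> ((c - b) * s) * (\<theta> * (1 - l))"
          unfolding v_def c(2) by (simp add: algebra_simps)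
        then show ?thesis unfolding c(1) using l \<theta> by (simp add: mult_le_cancel_right)
      qed
      then have "exp ((a - b) * u + (a / \<theta> - a) * CARD('n)) \<le> exp ((a / \<theta> - b) * s)" by simp
      then show ?thesis
        by (simp add: powr_def \<rho>a Rb r_def flip: exp_diff exp_add) (simp add: algebra_simps)
    qed
    then have "C * ((R / \<rho>) powr u * (\<rho> / r) powr CARD('n)) \<le> C * (R / r) powr s"
      using \<open>0 < C\<close> by simp
    with main have "(C * (R / \<rho>) powr u) * (\<rho> / r) powr CARD('n) \<le> (real (card L) * K) * (\<rho> / r) powr CARD('n)"
      by (simp only: mult.assoc)
    then have "C * (R / \<rho>) powr u \<le> real (card L) * K"
      using r \<rho> by (simp add: mult_le_cancel_right)
    then show ?thesis using K by (simp add: pos_divide_le_eq)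
  qed
  then show ?thesis
    unfolding lower_exponent_def using \<open>0 \<le> u\<close> \<open>0 < C\<close> K
    by (intro conjI exI[of _ "C / K"]) auto
qed

text \<open>
  The inequality for \<open>l * \<theta>\<close> is \<open>lower_exponent_rescale\<close> solved for \<open>s\<close>. For \<open>l = 1\<close> it
  reduces to the bound of the spectrum by the dimension.
\<close>
theorem scaled_spectrum_in_spectrum_class:
  fixes X :: "(real ^ 'n) set"
  assumes "X \<noteq> {}" and range: "\<phi> \<in> {0<..1} \<rightarrow> {0..real CARD('n)}"
    and spectrum: "\<forall>\<theta>\<in>{0<..1}. scaled_monotone_lower_spectrum \<theta> X = ereal (\<phi> \<theta>)"
  shows "\<phi> \<in> spectrum_class (real CARD('n))"
proof -
  define D where "D \<theta> = \<phi> \<theta> / (1 - \<theta>)" for \<theta>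
  have sup: "Sup (ereal ` {s. lower_exponent \<theta> X s}) = ereal (D \<theta>)" if "0 < \<theta>" "\<theta> < 1" for \<theta>
  proof -
    have "ereal (1 - \<theta>) * Sup (ereal ` {s. lower_exponent \<theta> X s}) = ereal (\<phi> \<theta>)"
      using spectrum[rule_format, of \<theta>] that by (simp add: scaled_monotone_lower_spectrum_def monotone_lower_spectrum_eq)
    then show ?thesis using that unfolding D_def
      by (cases "Sup (ereal ` {s. lower_exponent \<theta> X s})") (auto simp: field_simps)
  qed
  have upper: "s \<le> D \<theta>" if "lower_exponent \<theta> X s" "0 < \<theta>" "\<theta> < 1" for s \<theta>
  proof -
    have "ereal s \<le> Sup (ereal ` {s. lower_exponent \<theta> X s})" using that by (intro Sup_upper) auto
    then show ?thesis using sup that by simp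
  qed
  have least: "D \<theta> \<le> c" if "\<And>s. lower_exponent \<theta> X s \<Longrightarrow> s \<le> c" "0 < \<theta>" "\<theta> < 1" for c \<theta>
  proof -
    have "Sup (ereal ` {s. lower_exponent \<theta> X s}) \<le> ereal c" using that by (intro Sup_least) auto
    then show ?thesis using sup that by simp
  qed
  have one: "\<phi> 1 = 0" using spectrum[rule_format, of 1] by (simp add: zero_ereal_def scaled_monotone_lower_spectrum_def)
  have "\<phi> (l * \<theta>) \<le> (1 - \<theta>) * CARD('n) + \<theta> * \<phi> l"
    if l: "l \<in> {0<..1}" and \<theta>: "\<theta> \<in> {0<..1}" for l \<theta>
  proof -
    consider "\<theta> = 1" | "l = 1" "\<theta> < 1" | "l < 1" "\<theta> < 1" using l \<theta> by fastforce
    then show ?thesis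
    proof cases
      case 2
      have "D \<theta> \<le> CARD('n)"
        using lower_exponent_le_dim[OF _ \<open>X \<noteq> {}\<close>] \<theta> 2 by (intro least) auto
      then show ?thesis using 2 \<theta> one by (simp add: D_def pos_divide_le_eq mult.commute)
    next
      case 3
      have "l * \<theta> < 1 * 1" using l \<theta> 3 by (intro mult_strict_mono) auto
      then have lt: "0 < l * \<theta>" "l * \<theta> < 1" using l \<theta> by auto
      have "D (l * \<theta>) \<le> ((1 - \<theta>) * CARD('n) + \<theta> * \<phi> l) / (1 - l * \<theta>)"
      proof (rule least)
        fix s assume s: "lower_exponent (l * \<theta>) X s"
        define v where "v = s * (1 - l * \<theta>) - (1 - \<theta>) * CARD('n)"
        have "v / (\<theta> * (1 - l)) \<le> D l"
        proof (cases "0 \<le> v / (\<theta> * (1 - l))")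
          case True
          then show ?thesis
            using lower_exponent_rescale[OF s \<open>X \<noteq> {}\<close>, folded v_def] l \<theta> 3 by (intro upper) auto
        next
          case False
          have "0 \<le> D l" using l 3 range by (auto simp: D_def Pi_iff)
          then show ?thesis using False by simp
        qed
        then have "v \<le> \<theta> * \<phi> l"
          unfolding D_def using l \<theta> 3 by (simp add: pos_divide_le_eq mult.commute)
        then show "s \<le> ((1 - \<theta>) * CARD('n) + \<theta> * \<phi> l) / (1 - l * \<theta>)"
          using lt by (simp add: v_def pos_le_divide_eq)
      qed (use lt in auto)
      then show ?thesis using lt by (simp add: D_def divide_le_cancel)
    qed simp
  qed
  moreover have "antimono_on {0<..<1} D"
  proof (rule monotone_onI)
    fix x y :: real assume xy: "x \<in> {0<..<1}" "y \<in> {0<..<1}" "x \<le> y"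
    then show "D y \<le> D x"
      using lower_exponent_mono[of y X _ x] by (intro least upper) auto
  qed
  ultimately show ?thesis
    using range one unfolding spectrum_class_def D_def by blast
qed

section \<open>Separated sets and binary digit sets\<close>

text \<open>
  Covering numbers are bounded below by separated sets: a ball of radius less than \<open>\<epsilon> / 2\<close>
  contains at most one point of an \<open>\<epsilon>\<close>-separated set. The parameter \<open>M\<close> is real, so that the
  estimates can be combined with powers.
\<close>
definition separated :: "real set \<Rightarrow> real \<Rightarrow> real \<Rightarrow> real \<Rightarrow> real \<Rightarrow> bool" where
  "separated T x R \<epsilon> M \<longleftrightarrow> (\<exists>G. finite G \<and> G \<subseteq> T \<and> (\<forall>g\<in>G. \<bar>g - x\<bar> \<le> R) \<and>
     (\<forall>g\<in>G. \<forall>h\<in>G. g \<noteq> h \<longrightarrow> \<epsilon> \<le> \<bar>g - h\<bar>) \<and> M \<le> real (card G))"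

lemma separated_mono:
  assumes "separated T x R \<epsilon> M" "T \<subseteq> T'" "\<bar>x - y\<bar> + R \<le> R'" "\<epsilon>' \<le> \<epsilon>" "M' \<le> M"
  shows "separated T' y R' \<epsilon>' M'"
proof -
  obtain G where G: "finite G" "G \<subseteq> T" "\<And>g. g \<in> G \<Longrightarrow> \<bar>g - x\<bar> \<le> R"
    "\<And>g h. g \<in> G \<Longrightarrow> h \<in> G \<Longrightarrow> g \<noteq> h \<Longrightarrow> \<epsilon> \<le> \<bar>g - h\<bar>" "M \<le> real (card G)"
    using assms(1) unfolding separated_def by blast
  have "\<bar>g - y\<bar> \<le> R'" if "g \<in> G" for g using G(3)[OF that] assms(3) by linarith
  moreover have "\<epsilon>' \<le> \<bar>g - h\<bar>" if "g \<in> G" "h \<in> G" "g \<noteq> h" for g h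
    using G(4)[OF that] assms(4) by linarith
  moreover have "G \<subseteq> T'" "M' \<le> real (card G)" using G(2,5) assms(2,5) by auto
  ultimately show ?thesis unfolding separated_def using G(1) by blast
qed

lemma separated_singleton:
  assumes "x \<in> T" "0 \<le> R" "M \<le> 1"
  shows "separated T x R \<epsilon> M"
  unfolding separated_def using assms by (intro exI[of _ "{x}"]) auto

lemma separated_affine:
  assumes "separated S z R \<epsilon> M" "0 < c"
  shows "separated ((\<lambda>z. p + z / c) ` S) (p + z / c) (R / c) (\<epsilon> / c) M"
proof -
  obtain G where G: "finite G" "G \<subseteq> S" "\<forall>g\<in>G. \<bar>g - z\<bar> \<le> R"
    "\<forall>g\<in>G. \<forall>h\<in>G. g \<noteq> h \<longrightarrow> \<epsilon> \<le> \<bar>g - h\<bar>" "M \<le> real (card G)"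
    using assms(1) unfolding separated_def by blast
  have diff: "\<bar>g / c - h / c\<bar> = \<bar>g - h\<bar> / c" for g h
    using assms(2) by (simp flip: diff_divide_distrib)
  have "card ((\<lambda>z. p + z / c) ` G) = card G"
    using assms(2) by (intro card_image inj_onI) simp
  then show ?thesis
    unfolding separated_def using G assms(2)
    by (intro exI[of _ "(\<lambda>z. p + z / c) ` G"]) (auto simp: diff divide_right_mono)
qed

lemma separated_interval:
  assumes "{x..x + w} \<subseteq> T \<or> {x - w..x} \<subseteq> T" "0 \<le> w" "0 < \<epsilon>"
  shows "separated T x w \<epsilon> (w / \<epsilon>)"
proof -
  obtain \<sigma> :: real where \<sigma>: "\<bar>\<sigma>\<bar> = 1" and T: "\<And>y. 0 \<le> y \<Longrightarrow> y \<le> w \<Longrightarrow> x + \<sigma> * y \<in> T"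
    using assms(1)
  proof
    assume "{x..x + w} \<subseteq> T"
    then show ?thesis by (intro that[of 1]) auto
  next
    assume "{x - w..x} \<subseteq> T"
    then show ?thesis by (intro that[of "-1"]) auto
  qed
  define N where "N = nat \<lfloor>w / \<epsilon>\<rfloor>"
  have N: "real N \<le> w / \<epsilon>" "w / \<epsilon> \<le> real N + 1"
    using assms(2,3) by (auto simp: N_def)
  define f where "f i = x + \<sigma> * (real i * \<epsilon>)" for i :: nat
  have diff: "\<bar>f i - f k\<bar> = \<bar>real i - real k\<bar> * \<epsilon>" for i k
  proof -
    have "f i - f k = \<sigma> * ((real i - real k) * \<epsilon>)" by (simp add: f_def algebra_simps)
    then show ?thesis using \<sigma> assms(3) by (simp add: abs_mult)
  qed
  have small: "real i * \<epsilon> \<le> w" if "i \<le> N" for i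
  proof -
    have "real i \<le> w / \<epsilon>" using that N(1) by linarith
    then show ?thesis using assms(3) by (simp add: pos_le_divide_eq)
  qed
  have "inj f"
  proof (rule injI)
    fix i k assume "f i = f k"
    then show "i = k" using diff[of i k] assms(3) by simp
  qed
  then have "card (f ` {..N}) = N + 1" by (simp add: card_image inj_on_subset)
  moreover have "\<epsilon> \<le> \<bar>f i - f k\<bar>" if "f i \<noteq> f k" for i k
  proof -
    have "i \<noteq> k" using that by auto
    then have "1 \<le> \<bar>real i - real k\<bar>" by linarith
    then show ?thesis unfolding diff using assms(3) by (simp add: mult_le_cancel_right1)
  qed
  moreover have "\<bar>f i - x\<bar> \<le> w" "f i \<in> T" if "i \<le> N" for i
    using small[OF that] \<sigma> assms(3) T by (auto simp: f_def abs_mult)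
  ultimately show ?thesis
    unfolding separated_def using N by (intro exI[of _ "f ` {..N}"]) auto
qed

text \<open>
  The union of the unit intervals \<open>[k, k + 1]\<close> over the natural numbers \<open>k\<close> whose binary digits
  vanish outside the positions in \<open>A\<close>; this reading requires a finite \<open>A\<close>, since \<open>set_encode\<close> is
  \<open>0\<close> on infinite sets.
\<close>
definition digit_sums :: "nat set \<Rightarrow> real set" where
  "digit_sums A = {real (set_encode B) + v | B v. B \<subseteq> A \<and> 0 \<le> v \<and> v \<le> 1}"

lemma digit_sumsI:
  "B \<subseteq> A \<Longrightarrow> 0 \<le> v \<Longrightarrow> v \<le> 1 \<Longrightarrow> real (set_encode B) + v \<in> digit_sums A"
  unfolding digit_sums_def by blast

lemma set_encode_Un_disjoint:
  assumes "finite A" "finite B" "A \<inter> B = {}"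
  shows "set_encode (A \<union> B) = set_encode A + set_encode B"
  using assms by (simp add: set_encode_def sum.union_disjoint)

lemma set_encode_window:
  assumes "B \<subseteq> {b..<a}" 
  shows "2 ^ b dvd set_encode B" and "b \<le> a \<Longrightarrow> set_encode B + 2 ^ b \<le> 2 ^ a"
proof -
  show "2 ^ b dvd set_encode B"
    unfolding set_encode_def using assms by (intro dvd_sum le_imp_power_dvd) auto
  assume "b \<le> a"
  have "set_encode B \<le> (\<Sum>i = b..<a. 2 ^ i)"
    unfolding set_encode_def using assms by (intro sum_mono2) auto
  also have "\<dots> + 2 ^ b = (2::nat) ^ a"
    using \<open>b \<le> a\<close> by (induction rule: dec_induct) auto
  finally show "set_encode B + 2 ^ b \<le> 2 ^ a" by simp
qed

lemma digit_sums_subset: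
  assumes "A \<subseteq> {..<L}"
  shows "digit_sums A \<subseteq> {0..2 ^ L}"
proof
  fix z assume "z \<in> digit_sums A"
  then obtain B v where B: "B \<subseteq> A" and z: "z = real (set_encode B) + v" "0 \<le> v" "v \<le> 1"
    unfolding digit_sums_def by blast
  have "B \<subseteq> {0..<L}" using B assms by auto
  then have "set_encode B + 1 \<le> 2 ^ L" using set_encode_window(2)[of B 0 L] by simp
  then have "real (set_encode B + 1) \<le> real (2 ^ L)" by (rule of_nat_mono)
  then show "z \<in> {0..2 ^ L}" using z by simp
qed

text \<open>
  Rewriting freely the digits of a point at the positions of \<open>A\<close> in the window from \<open>b\<close> to \<open>a\<close>
  moves it by less than \<open>2^a\<close>, and produces integers that differ by multiples of \<open>2^b\<close>.
  The set \<open>V\<close> of fractional parts allows for two uses: with a single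
  fractional part it yields a separation \<open>2^b\<close>, and with \<open>b = 0\<close> and a grid in the unit interval
  it yields separations below \<open>1\<close>.
\<close>
lemma separated_digit_sums:
  assumes "finite A" "B \<subseteq> A" "b \<le> a" "0 \<le> v" "v \<le> 1"
    and V: "finite V" "V \<subseteq> {0..1}" "0 < \<epsilon>"
      "\<And>t. t \<in> V \<Longrightarrow> \<bar>t - v\<bar> \<le> 2 ^ b"
      "\<And>t t'. t \<in> V \<Longrightarrow> t' \<in> V \<Longrightarrow> \<bar>t - t'\<bar> + \<epsilon> \<le> 2 ^ b"
      "\<And>t t'. t \<in> V \<Longrightarrow> t' \<in> V \<Longrightarrow> t \<noteq> t' \<Longrightarrow> \<epsilon> \<le> \<bar>t - t'\<bar>"
  shows "separated (digit_sums A) (real (set_encode B) + v) (2 ^ a) \<epsilon>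
    (real (card V) * 2 ^ card (A \<inter> {b..<a}))"
proof -
  define W where "W = {b..<a}"
  define f where "f = (\<lambda>(B', t). real (set_encode ((B - W) \<union> B')) + t)"
  have fin: "finite B" using assms(1,2) by (rule rev_finite_subset)
  have enc: "f (B', t) = real (set_encode (B - W)) + real (set_encode B') + t" if "B' \<subseteq> A \<inter> W" for B' t
  proof -
    have "set_encode ((B - W) \<union> B') = set_encode (B - W) + set_encode B'"
      using that fin assms(1) by (intro set_encode_Un_disjoint) (auto intro: finite_subset)
    then show ?thesis by (simp add: f_def)
  qed
  have x: "f (B \<inter> W, v) = real (set_encode B) + v"
    by (simp add: f_def Diff_Int_distrib Un_Diff_Int)
  have win: "real (set_encode B') + 2 ^ b \<le> 2 ^ a" if "B' \<subseteq> W" for B'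
  proof -
    have "set_encode B' + 2 ^ b \<le> 2 ^ a" using set_encode_window(2) that assms(3) by (simp add: W_def)
    then have "real (set_encode B' + 2 ^ b) \<le> real (2 ^ a)" by (rule of_nat_mono)
    then show ?thesis by simp
  qed
  define Q where "Q = Pow (A \<inter> W) \<times> V"
  have sep: "\<epsilon> \<le> \<bar>f q - f q'\<bar>" if q: "q \<in> Q" "q' \<in> Q" "q \<noteq> q'" for q q'
  proof -
    obtain B1 t1 B2 t2 where q12: "q = (B1, t1)" "q' = (B2, t2)" by (metis surj_pair)
    have B12: "B1 \<subseteq> A \<inter> W" "B2 \<subseteq> A \<inter> W" and t12: "t1 \<in> V" "t2 \<in> V"
      using q q12 by (auto simp: Q_def)
    show ?thesis
    proof (cases "B1 = B2")
      case True
      then show ?thesis using q q12 V(6)[OF t12] B12 by (simp add: enc)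
    next
      case False
      have "finite B1" "finite B2" using B12 assms(1) by (auto intro: finite_subset)
      then have ne: "set_encode B1 \<noteq> set_encode B2" using False by (metis set_encode_inverse)
      have "int (2 ^ b) dvd int (set_encode B1) - int (set_encode B2)"
        using B12 set_encode_window(1)[of _ b a] by (intro dvd_diff) (auto simp: W_def simp del: of_nat_power)
      then have "int (2 ^ b) \<le> \<bar>int (set_encode B1) - int (set_encode B2)\<bar>"
        using ne by (intro zdvd_imp_le) auto
      then have "real_of_int (2 ^ b) \<le> real_of_int \<bar>int (set_encode B1) - int (set_encode B2)\<bar>"
        by (simp only: of_int_le_iff of_nat_power of_nat_numeral)
      then have "2 ^ b \<le> \<bar>real (set_encode B1) - real (set_encode B2)\<bar>" by simp
      then show ?thesis using V(5)[OF t12] B12 q12 by (simp add: enc)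
    qed
  qed
  have sep_image: "\<epsilon> \<le> \<bar>g - h\<bar>" if gh: "g \<in> f ` Q" "h \<in> f ` Q" "g \<noteq> h" for g h
  proof -
    obtain q q' where "q \<in> Q" "g = f q" "q' \<in> Q" "h = f q'" using gh(1,2) by (elim imageE)
    then show ?thesis using sep[of q q'] gh(3) by auto
  qed
  have "inj_on f Q"
  proof (rule inj_onI, rule ccontr)
    fix q q' assume "q \<in> Q" "q' \<in> Q" "f q = f q'" "q \<noteq> q'"
    then show False using sep[of q q'] V(3) by simp
  qed
  moreover have "finite Q" using assms(1) V(1) by (simp add: Q_def)
  ultimately have "card (f ` Q) = card V * 2 ^ card (A \<inter> W)"
    using assms(1) by (simp add: card_image Q_def card_cartesian_product card_Pow del: Pow_Int_eq)
  moreover have "f ` Q \<subseteq> digit_sums A"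
  proof clarify
    fix B' t assume "(B', t) \<in> Q"
    then have "(B - W) \<union> B' \<subseteq> A" "t \<in> {0..1}" using assms(2) V(2) by (auto simp: Q_def)
    then show "f (B', t) \<in> digit_sums A" unfolding digit_sums_def f_def by auto
  qed
  moreover have "\<bar>g - (real (set_encode B) + v)\<bar> \<le> 2 ^ a" if g: "g \<in> f ` Q" for g
  proof -
    obtain B' t where q: "g = f (B', t)" and B': "B' \<subseteq> A \<inter> W" and t: "t \<in> V"
      using g unfolding Q_def by (elim imageE SigmaE) auto
    have "\<bar>real (set_encode B') - real (set_encode (B \<inter> W))\<bar> + 2 ^ b \<le> 2 ^ a"
      using win[of B'] win[of "B \<inter> W"] B' by auto
    moreover have "g - f (B \<inter> W, v) = real (set_encode B') - real (set_encode (B \<inter> W)) + (t - v)"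
      using B' assms(2) by (subst enc | force simp: q enc)+
    ultimately show ?thesis using V(4)[OF t] unfolding x by linarith
  qed
  ultimately show ?thesis
    unfolding separated_def W_def[symmetric] using \<open>finite Q\<close> sep_image
    by (intro exI[of _ "f ` Q"] conjI ballI impI) simp_all
qed

text \<open>
  The positions at which the Beatty sequence of slope \<open>s\<close> jumps: they have density \<open>s\<close> in every
  window, with an error of at most \<open>1\<close>.
\<close>
definition beatty_digits :: "real \<Rightarrow> nat set" where
  "beatty_digits s = {i. \<lfloor>real i * s\<rfloor> < \<lfloor>real (Suc i) * s\<rfloor>}"

lemma card_beatty_digits:
  assumes "0 \<le> s" "s \<le> 1" "b \<le> a"
  shows "int (card (beatty_digits s \<inter> {b..<a})) = \<lfloor>real a * s\<rfloor> - \<lfloor>real b * s\<rfloor>"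
  using assms(3)
proof (induction rule: dec_induct)
  case (step k)
  have "real (Suc k) * s = real k * s + s" by (simp add: algebra_simps)
  then have "\<lfloor>real (Suc k) * s\<rfloor> = \<lfloor>real k * s\<rfloor> \<or> \<lfloor>real (Suc k) * s\<rfloor> = \<lfloor>real k * s\<rfloor> + 1"
    using assms(1,2) by linarith
  moreover have "{b..<Suc k} = insert k {b..<k}" using step by auto
  moreover have "k \<in> beatty_digits s \<longleftrightarrow> \<lfloor>real k * s\<rfloor> < \<lfloor>real (Suc k) * s\<rfloor>"
    by (simp add: beatty_digits_def)
  ultimately show ?case using step.IH by (cases "k \<in> beatty_digits s") auto
qed simp

lemma card_beatty_digits_bounds:
  assumes "0 \<le> s" "s \<le> 1" "b \<le> a"
  shows "s * (real a - real b) - 1 \<le> real (card (beatty_digits s \<inter> {b..<a}))"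
    and "real (card (beatty_digits s \<inter> {0..<a})) \<le> s * real a"
proof -
  have "real (card (beatty_digits s \<inter> {b..<a})) = of_int (\<lfloor>real a * s\<rfloor> - \<lfloor>real b * s\<rfloor>)"
    using card_beatty_digits[OF assms] by (metis of_int_of_nat_eq)
  then show "s * (real a - real b) - 1 \<le> real (card (beatty_digits s \<inter> {b..<a}))"
    by (simp add: algebra_simps) linarith
  have "real (card (beatty_digits s \<inter> {0..<a})) = of_int (\<lfloor>real a * s\<rfloor> - \<lfloor>real 0 * s\<rfloor>)"
    using card_beatty_digits[OF assms(1,2), of 0 a] by (metis of_int_of_nat_eq le0)
  then show "real (card (beatty_digits s \<inter> {0..<a})) \<le> s * real a"
    by (simp add: algebra_simps)
qed

section \<open>A line with isolated pieces\<close>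

text \<open>
  The digit set of density \<open>s\<close>, scaled to lie between the scales \<open>2^-n\<close> and \<open>2^-m\<close>
  and moved to start at \<open>p\<close>.
\<close>
definition digit_piece :: "real \<Rightarrow> nat \<Rightarrow> nat \<Rightarrow> real \<Rightarrow> real set" where
  "digit_piece p m n s = (\<lambda>z. p + z / 2 ^ n) ` digit_sums (beatty_digits s \<inter> {..<n - m})"

lemma digit_piece_subset:
  assumes "m \<le> n"
  shows "digit_piece p m n s \<subseteq> {p..p + 1 / 2 ^ m}"
proof -
  have "z / 2 ^ n \<le> 1 / 2 ^ m" if "z \<le> 2 ^ (n - m)" for z :: real
  proof -
    have "z / 2 ^ n \<le> 2 ^ (n - m) / 2 ^ n" using that by (intro divide_right_mono) auto
    also have "\<dots> = 1 / 2 ^ m" using assms by (simp add: power_diff)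
    finally show ?thesis .
  qed
  moreover have "digit_sums (beatty_digits s \<inter> {..<n - m}) \<subseteq> {0..2 ^ (n - m)}"
    by (rule digit_sums_subset) simp
  ultimately show ?thesis unfolding digit_piece_def by fastforce
qed

text \<open>
  Below the scale \<open>2^-n\<close> the piece is a union of intervals of length \<open>2^-n\<close>, and on one side of each
  of its points at least half of such an interval remains.
\<close>
lemma separated_digit_piece_below:
  assumes "x \<in> digit_piece p m n s" "n \<le> P" "0 < \<epsilon>"
  shows "separated (digit_piece p m n s) x (1 / 2 ^ (P + 1)) \<epsilon> (1 / 2 ^ (P + 1) / \<epsilon>)"
proof (rule separated_interval)
  obtain B v where B: "B \<subseteq> beatty_digits s \<inter> {..<n - m}" and v: "0 \<le> v" "v \<le> 1"
    and x: "x = p + (real (set_encode B) + v) / 2 ^ n"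
    using assms(1) unfolding digit_piece_def digit_sums_def by blast
  have small: "1 / 2 ^ (P + 1) * 2 ^ n \<le> (1 / 2 :: real)"
    using assms(2) by (simp add: pos_divide_le_eq)
  have mem: "y \<in> digit_piece p m n s" if "0 \<le> v + (y - x) * 2 ^ n" "v + (y - x) * 2 ^ n \<le> 1" for y
  proof -
    have "real (set_encode B) + (v + (y - x) * 2 ^ n) \<in> digit_sums (beatty_digits s \<inter> {..<n - m})"
      unfolding digit_sums_def using B that by blast
    moreover have "y = p + (real (set_encode B) + (v + (y - x) * 2 ^ n)) / 2 ^ n"
      by (simp add: x field_simps)
    ultimately show ?thesis unfolding digit_piece_def by blast
  qed
  show "{x..x + 1 / 2 ^ (P + 1)} \<subseteq> digit_piece p m n s \<or> {x - 1 / 2 ^ (P + 1)..x} \<subseteq> digit_piece p m n s"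
  proof (cases "v \<le> 1 / 2")
    case True
    have "{x..x + 1 / 2 ^ (P + 1)} \<subseteq> digit_piece p m n s"
    proof (intro subsetI mem)
      fix y assume y: "y \<in> {x..x + 1 / 2 ^ (P + 1)}"
      then have "(y - x) * 2 ^ n \<le> 1 / 2 ^ (P + 1) * 2 ^ n" by (intro mult_right_mono) auto
      moreover have "0 \<le> (y - x) * 2 ^ n" using y by simp
      ultimately show "0 \<le> v + (y - x) * 2 ^ n" "v + (y - x) * 2 ^ n \<le> 1"
        using True v small by linarith+
    qed
    then show ?thesis by blast
  next
    case False
    have "{x - 1 / 2 ^ (P + 1)..x} \<subseteq> digit_piece p m n s"
    proof (intro subsetI mem)
      fix y assume y: "y \<in> {x - 1 / 2 ^ (P + 1)..x}"
      then have "(x - y) * 2 ^ n \<le> 1 / 2 ^ (P + 1) * 2 ^ n" by (intro mult_right_mono) auto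
      moreover have "0 \<le> (x - y) * 2 ^ n" using y by simp
      moreover have "(y - x) * 2 ^ n = - ((x - y) * 2 ^ n)" by (simp add: algebra_simps)
      ultimately show "0 \<le> v + (y - x) * 2 ^ n" "v + (y - x) * 2 ^ n \<le> 1"
        using False v small by linarith+
    qed
    then show ?thesis by blast
  qed
qed (use assms in auto)

text \<open>
  Between the outer scale \<open>2^-P\<close> and \<open>2^-q\<close> the free digits contribute the exponent \<open>s\<close>. From
  there to \<open>2^-\<rho>\<close>, in case \<open>\<rho>\<close> exceeds \<open>n\<close>, the intervals contribute the exponent \<open>1\<close>.
\<close>
lemma separated_digit_piece:
  assumes x: "x \<in> digit_piece p m n s" and s: "0 \<le> s" "s \<le> 1" and P: "m \<le> P" "P \<le> n" "P \<le> \<rho>"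
  defines "q \<equiv> min \<rho> n"
  shows "separated (digit_piece p m n s) x (1 / 2 ^ P) (1 / 2 ^ \<rho>)
    (2 powr (s * (real q - real P) + (real \<rho> - real q) - 1))"
proof -
  define A where "A = beatty_digits s \<inter> {..<n - m}"
  obtain B v where B: "B \<subseteq> A" and v: "0 \<le> v" "v \<le> 1"
    and xeq: "x = p + (real (set_encode B) + v) / 2 ^ n"
    using x unfolding digit_piece_def digit_sums_def A_def by blast
  define k where "k = \<rho> - q"
  define V where "V = (if \<rho> \<le> n then {v} else (\<lambda>i. real i / 2 ^ k) ` {..<2 ^ k})"
  have inj: "inj_on (\<lambda>i. real i / 2 ^ k) {..<2 ^ k}" by (rule inj_onI) simp
  have cardV: "card V = 2 ^ k" using inj by (auto simp: V_def card_image k_def q_def)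
  define \<epsilon> :: real where "\<epsilon> = 2 ^ (n - q) / 2 ^ k"
  have sep: "separated (digit_sums A) (real (set_encode B) + v) (2 ^ (n - P)) \<epsilon>
      (real (card V) * 2 ^ card (A \<inter> {n - q..<n - P}))"
  proof (rule separated_digit_sums)
    show "finite A" by (simp add: A_def)
    show "n - q \<le> n - P" using P by (simp add: q_def)
    show "finite V" "0 < \<epsilon>" by (auto simp: V_def \<epsilon>_def)
    have range: "i + 1 \<le> 2 ^ k" if "i < 2 ^ k" for i :: nat using that by simp
    have lt: "real i + 1 \<le> 2 ^ k" if "i < 2 ^ k" for i :: nat
      using of_nat_mono[OF range[OF that], where 'a = real] by simp
    have frac: "real i / 2 ^ k + 1 / 2 ^ k \<le> 1" if "i < 2 ^ k" for i :: nat
      using lt[OF that] by (simp add: pos_divide_le_eq flip: add_divide_distrib)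
    have V01: "0 \<le> t \<and> t \<le> 1" if "t \<in> V" for t
      using that v frac by (force simp: V_def split: if_splits)
    then show "V \<subseteq> {0..1}" by auto
    show "\<bar>t - v\<bar> \<le> 2 ^ (n - q)" if "t \<in> V" for t
    proof -
      have "(1::real) \<le> 2 ^ (n - q)" by simp
      then show ?thesis using V01[OF that] v by linarith
    qed
    show "\<bar>t - t'\<bar> + \<epsilon> \<le> 2 ^ (n - q)" if tt: "t \<in> V" "t' \<in> V" for t t'
    proof (cases "\<rho> \<le> n")
      case True
      then show ?thesis using tt by (simp add: V_def \<epsilon>_def k_def q_def)
    next
      case False
      then obtain i j where "t = real i / 2 ^ k" "i < 2 ^ k" "t' = real j / 2 ^ k" "j < 2 ^ k"
        using tt by (auto simp: V_def)
      then have "t + 1 / 2 ^ k \<le> 1" "t' + 1 / 2 ^ k \<le> 1" using frac by auto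
      moreover have "0 \<le> t" "0 \<le> t'" using V01 tt by auto
      moreover have "\<epsilon> = 1 / 2 ^ k" "n - q = 0" using False by (auto simp: \<epsilon>_def q_def)
      ultimately show ?thesis by (auto simp: abs_if)
    qed
    show "\<epsilon> \<le> \<bar>t - t'\<bar>" if tt: "t \<in> V" "t' \<in> V" "t \<noteq> t'" for t t'
    proof (cases "\<rho> \<le> n")
      case True
      then show ?thesis using tt by (simp add: V_def)
    next
      case False
      then obtain i j where ij: "t = real i / 2 ^ k" "t' = real j / 2 ^ k"
        using tt by (auto simp: V_def)
      then have "1 \<le> \<bar>real i - real j\<bar>" using tt(3) by (cases "i = j") auto
      then have "1 / 2 ^ k \<le> \<bar>real i - real j\<bar> / 2 ^ k" by (intro divide_right_mono) auto
      moreover have "\<bar>real i - real j\<bar> / 2 ^ k = \<bar>t - t'\<bar>"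
        unfolding ij by (simp flip: diff_divide_distrib)
      moreover have "\<epsilon> = 1 / 2 ^ k" using False by (auto simp: \<epsilon>_def q_def)
      ultimately show ?thesis by simp
    qed
  qed (use B v in auto)
  have sep': "separated (digit_piece p m n s) x (2 ^ (n - P) / 2 ^ n) (\<epsilon> / 2 ^ n)
      (real (card V) * 2 ^ card (A \<inter> {n - q..<n - P}))"
    unfolding digit_piece_def A_def[symmetric] xeq by (rule separated_affine[OF sep]) simp
  show ?thesis
  proof (rule separated_mono[OF sep' order_refl])
    show "\<bar>x - x\<bar> + 2 ^ (n - P) / 2 ^ n \<le> 1 / 2 ^ P" using P by (simp add: power_diff)
    have "\<epsilon> / 2 ^ n = 1 / 2 ^ \<rho>"
    proof (cases "\<rho> \<le> n")
      case True
      then show ?thesis by (simp add: \<epsilon>_def q_def k_def power_diff)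
    next
      case False
      then have "(2::real) ^ \<rho> = 2 ^ k * 2 ^ n" by (simp add: k_def q_def flip: power_add)
      then show ?thesis using False by (simp add: \<epsilon>_def q_def)
    qed
    then show "1 / 2 ^ \<rho> \<le> \<epsilon> / 2 ^ n" by simp
    have "A \<inter> {n - q..<n - P} = beatty_digits s \<inter> {n - q..<n - P}"
      using P by (auto simp: A_def)
    then have "s * (real (n - P) - real (n - q)) - 1 \<le> real (card (A \<inter> {n - q..<n - P}))"
      using card_beatty_digits_bounds(1)[OF s, of "n - q" "n - P"] P by (simp add: q_def)
    moreover have "real (n - P) - real (n - q) = real q - real P" using P by (simp add: q_def)
    moreover have "real k = real \<rho> - real q" by (simp add: k_def q_def)
    ultimately have "2 powr (s * (real q - real P) + (real \<rho> - real q) - 1)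
        \<le> 2 powr (real k + real (card (A \<inter> {n - q..<n - P})))"
      by (intro powr_mono) auto
    also have "\<dots> = real (card V) * 2 ^ card (A \<inter> {n - q..<n - P})"
      by (simp add: cardV powr_add powr_realpow)
    finally show "2 powr (s * (real q - real P) + (real \<rho> - real q) - 1)
        \<le> real (card V) * 2 ^ card (A \<inter> {n - q..<n - P})" .
  qed
qed

text \<open>
  The \<open>j\<close>-th puncture has radius \<open>2 * 2^-m\<close>, twice the size of the piece inside it.
  Hence the ball of radius \<open>2^-m\<close> about the start of the piece meets nothing else, while the rest of
  the line is within \<open>2 * 2^-m\<close> of every point of the piece. As \<open>m\<close> is positive,
  punctures have radius at most \<open>1\<close> and stay far from each other.
\<close>
definition line_with_pieces :: "(nat \<Rightarrow> nat) \<Rightarrow> (nat \<Rightarrow> nat) \<Rightarrow> (nat \<Rightarrow> real) \<Rightarrow> real set" where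
  "line_with_pieces m n s = {x. \<forall>j. 2 / 2 ^ m j \<le> \<bar>x - 10 * real j\<bar>} \<union>
     (\<Union>j. digit_piece (10 * real j) (m j) (n j) (s j))"

lemma line_with_pieces_ray:
  assumes m: "\<And>j. 1 \<le> m j" and x: "\<And>j. 2 / 2 ^ m j \<le> \<bar>x - 10 * real j\<bar>"
  shows "{x..x + 1} \<subseteq> line_with_pieces m n s \<or> {x - 1..x} \<subseteq> line_with_pieces m n s"
proof -
  have small: "2 / 2 ^ m j \<le> (1::real)" for j
    using power_increasing[OF m[of j], of "2::real"] by simp
  have out: "y \<in> line_with_pieces m n s" if "\<And>j. 2 / 2 ^ m j \<le> \<bar>y - 10 * real j\<bar>" for y
    using that by (simp add: line_with_pieces_def)
  show ?thesis
  proof (cases "\<exists>i. \<bar>x - 10 * real i\<bar> \<le> 2")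
    case True
    then obtain i where i: "\<bar>x - 10 * real i\<bar> \<le> 2" by blast
    have far: "4 \<le> \<bar>y - 10 * real j\<bar>" if "j \<noteq> i" "\<bar>y - x\<bar> \<le> 1" for y j
    proof -
      have "1 \<le> \<bar>real j - real i\<bar>" using that by linarith
      then show ?thesis using i that by linarith
    qed
    have "y \<in> line_with_pieces m n s" if "\<bar>y - x\<bar> \<le> 1" "\<bar>x - 10 * real i\<bar> \<le> \<bar>y - 10 * real i\<bar>" for y
    proof (rule out)
      fix j show "2 / 2 ^ m j \<le> \<bar>y - 10 * real j\<bar>"
        using far[of j y] that x[of i] small[of j] by (cases "j = i") (simp, linarith)
    qed
    then show ?thesis by (cases "10 * real i \<le> x") (force intro!: disjI1, force intro!: disjI2)
  next
    case False
    have "y \<in> line_with_pieces m n s" if "\<bar>y - x\<bar> \<le> 1" for y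
    proof (rule out)
      fix j have "2 < \<bar>x - 10 * real j\<bar>" using False not_le by blast
      then show "2 / 2 ^ m j \<le> \<bar>y - 10 * real j\<bar>" using that small[of j] by linarith
    qed
    then show ?thesis by auto
  qed
qed

lemma line_with_pieces_near:
  assumes m: "\<And>j. 1 \<le> m j \<and> m j \<le> n j" and "x \<in> line_with_pieces m n s"
    and near: "\<bar>x - 10 * real i\<bar> \<le> 1 / 2 ^ m i"
  shows "x \<in> digit_piece (10 * real i) (m i) (n i) (s i)"
proof -
  have small: "1 / 2 ^ m j \<le> (1 / 2 ::real)" for j
    using power_increasing[of 1 "m j" "2::real"] m[of j] by (simp add: pos_divide_le_eq)
  have "2 / 2 ^ m i > (1 / 2 ^ m i :: real)" by (simp add: divide_strict_right_mono)
  then have "\<not> (\<forall>j. 2 / 2 ^ m j \<le> \<bar>x - 10 * real j\<bar>)"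
    using near by (metis linorder_not_le order_trans)
  then obtain j where j: "x \<in> digit_piece (10 * real j) (m j) (n j) (s j)"
    using assms(2) by (auto simp: line_with_pieces_def)
  then have "10 * real j \<le> x" "x \<le> 10 * real j + 1 / 2 ^ m j"
    using digit_piece_subset[of "m j" "n j" "10 * real j" "s j"] m by auto
  then have "\<bar>10 * real j - 10 * real i\<bar> \<le> 1" using near small[of i] small[of j] by linarith
  then have "j = i" by linarith
  then show ?thesis using j by simp
qed

text \<open>
  At a point of a piece, an outer radius of at least \<open>4 * 2^-m\<close> reaches the full part of the line, and
  an outer radius below \<open>2^-n\<close> sees an interval. In between the digits of the piece count; a
  radius \<open>2^-P\<close> above \<open>2^-m\<close> is then reduced to \<open>2^-m\<close>, which is at most one step.
\<close>
lemma separated_line_with_pieces: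
  assumes m: "\<And>j. 1 \<le> m j \<and> m j \<le> n j" and s: "\<And>j. 0 \<le> s j \<and> s j \<le> 1"
    and x: "x \<in> line_with_pieces m n s" and P: "P \<le> \<rho>"
  shows "separated (line_with_pieces m n s) x (1 / 2 ^ P) (1 / 2 ^ \<rho>) (2 powr (real \<rho> - real P - 1)) \<or>
    (\<exists>j. m j \<le> P + 1 \<and> P \<le> n j \<and>
      separated (line_with_pieces m n s) x (1 / 2 ^ P) (1 / 2 ^ \<rho>)
        (2 powr (s j * (real (min \<rho> (n j)) - real (max P (m j))) + (real \<rho> - real (min \<rho> (n j))) - 1)))"
    (is "?full \<or> _")
proof -
  let ?T = "line_with_pieces m n s"
  have pow: "1 / 2 ^ (P + 1) / (1 / 2 ^ \<rho>) = 2 powr (real \<rho> - real P - 1)"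
    by (simp add: powr_diff powr_realpow)
  have half: "1 / 2 ^ (P + 1) \<le> (1 / 2 ^ P :: real)" "1 / 2 ^ (P + 1) \<le> (1::real)"
  proof -
    have "(1::real) \<le> 2 ^ P" by simp
    then have "(1::real) \<le> 2 * 2 ^ P" by linarith
    then show "1 / 2 ^ (P + 1) \<le> (1 / 2 ^ P :: real)" "1 / 2 ^ (P + 1) \<le> (1::real)"
      by (auto simp: pos_divide_le_eq)
  qed
  have out: "separated ?T y (1 / 2 ^ (P + 1)) (1 / 2 ^ \<rho>) (2 powr (real \<rho> - real P - 1))"
    if "\<And>j. 2 / 2 ^ m j \<le> \<bar>y - 10 * real j\<bar>" for y
    unfolding pow[symmetric]
  proof (rule separated_interval)
    have "{y..y + 1} \<subseteq> ?T \<or> {y - 1..y} \<subseteq> ?T" using line_with_pieces_ray m that by blast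
    moreover have "{y..y + 1 / 2 ^ (P + 1)} \<subseteq> {y..y + 1}" "{y - 1 / 2 ^ (P + 1)..y} \<subseteq> {y - 1..y}"
      using half by auto
    ultimately show "{y..y + 1 / 2 ^ (P + 1)} \<subseteq> ?T \<or> {y - 1 / 2 ^ (P + 1)..y} \<subseteq> ?T"
      by (meson order_trans)
  qed auto
  consider "\<And>j. 2 / 2 ^ m j \<le> \<bar>x - 10 * real j\<bar>"
    | j where "x \<in> digit_piece (10 * real j) (m j) (n j) (s j)"
    using x unfolding line_with_pieces_def by blast
  then show ?thesis
  proof cases
    case 1
    then have ?full using out[OF 1] half by (elim separated_mono) auto
    then show ?thesis by blast
  next
    case 2
    have sub: "digit_piece (10 * real j) (m j) (n j) (s j) \<subseteq> ?T" by (auto simp: line_with_pieces_def)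
    consider "P + 2 \<le> m j" | "m j \<le> P + 1" "P \<le> n j" | "n j < P" by linarith
    then show ?thesis
    proof cases
      case 1
      define y where "y = 10 * real j + 2 / 2 ^ m j"
      have "2 / 2 ^ m i \<le> (1::real)" for i
        using power_increasing[of 1 "m i" "2::real"] m[of i] by simp
      then have "2 / 2 ^ m i \<le> \<bar>y - 10 * real i\<bar>" for i
      proof (cases "i = j")
        case False
        then have "1 \<le> \<bar>real j - real i\<bar>" by linarith
        moreover have "0 \<le> 2 / (2::real) ^ m j" by simp
        ultimately have "9 \<le> \<bar>y - 10 * real i\<bar>"
          using \<open>2 / 2 ^ m j \<le> (1::real)\<close> unfolding y_def by linarith
        then show ?thesis using \<open>2 / 2 ^ m i \<le> (1::real)\<close> by linarith
      qed (simp add: y_def)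
      note y = out[OF this]
      have "\<bar>y - x\<bar> \<le> 2 / 2 ^ m j"
        using digit_piece_subset[of "m j" "n j" "10 * real j" "s j"] m 2
        by (force simp: y_def abs_le_iff)
      also have "\<dots> \<le> 2 / 2 ^ (P + 2)" using 1 by (intro divide_left_mono power_increasing) auto
      finally have "\<bar>y - x\<bar> + 1 / 2 ^ (P + 1) \<le> 1 / 2 ^ P" by simp
      then have ?full using y by (elim separated_mono) auto
      then show ?thesis by blast
    next
      case 2
      let ?M = "2 powr (s j * (real (min \<rho> (n j)) - real (max P (m j))) + (real \<rho> - real (min \<rho> (n j))) - 1)"
      have "separated ?T x (1 / 2 ^ P) (1 / 2 ^ \<rho>) ?M"
      proof (cases "max P (m j) \<le> \<rho>")
        case True
        have "separated (digit_piece (10 * real j) (m j) (n j) (s j)) x (1 / 2 ^ max P (m j)) (1 / 2 ^ \<rho>) ?M"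
          using \<open>x \<in> digit_piece _ _ _ _\<close> True s m 2 by (intro separated_digit_piece) auto
        moreover have "1 / 2 ^ max P (m j) \<le> (1 / 2 ^ P :: real)"
          by (intro divide_left_mono power_increasing) auto
        ultimately show ?thesis using sub by (elim separated_mono) auto
      next
        case False
        then have "\<rho> = P" "m j = P + 1" using P 2 by auto
        then have "?M \<le> 2 powr 0" using m[of j] s[of j] by (intro powr_mono) (auto simp: min_def)
        then show ?thesis using x by (intro separated_singleton) auto
      qed
      then show ?thesis using 2 by blast
    next
      case 3
      have "separated (digit_piece (10 * real j) (m j) (n j) (s j)) x (1 / 2 ^ (P + 1)) (1 / 2 ^ \<rho>)
          (1 / 2 ^ (P + 1) / (1 / 2 ^ \<rho>))"
        using 2 3 by (intro separated_digit_piece_below) auto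
      then have ?full unfolding pow using half sub by (elim separated_mono) auto
      then show ?thesis by blast
    qed
  qed
qed

section \<open>Separation in terms of the given function\<close>

text \<open>
  The arithmetic core, in logarithms to base \<open>2\<close>: the exponent \<open>u\<close> of the class
  at \<open>\<theta>\<close> is matched by a piece with exponent \<open>s\<close>, up to a constant that is independent
  of the piece and the scales. If \<open>l \<le> \<theta>\<close>, then \<open>u \<le> s\<close> by the second inequality. If
  \<open>\<theta> < l\<close>, replace the right side by its value with \<open>n\<close> in place of \<open>q\<close>. What remains is linear and
  increasing in \<open>P\<close> and \<open>\<rho>\<close>, hence smallest at \<open>P = l n\<close> and \<open>\<rho> = P / \<theta>\<close>; there it is non-negative
  by the first inequality. The slack \<open>c\<^sub>0\<close> absorbs the rounding of scales to
  powers of \<open>2\<close>.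
\<close>
lemma spectrum_exponent_bound:
  fixes \<psi> :: "real \<Rightarrow> real"
  assumes \<psi>: "\<psi> \<in> spectrum_class 1" and \<theta>: "0 < \<theta>" "\<theta> < 1" and "0 \<le> c\<^sub>0"
    and mn: "1 \<le> m" "m < n" and P: "P \<le> \<rho>" "real P \<le> \<theta> * real \<rho> + c\<^sub>0" "m \<le> P + 1" "P \<le> n"
  defines "u \<equiv> \<psi> \<theta> / (1 - \<theta>)" and "l \<equiv> real m / real n"
  defines "s \<equiv> \<psi> l / (1 - l)" and "q \<equiv> min \<rho> n"
  shows "u * (real \<rho> - real P) - (3 + (1 + c\<^sub>0) / \<theta>)
    \<le> s * (real q - real (max P m)) + (real \<rho> - real q) - 1"
proof -
  have l: "0 < l" "l < 1" "l * n = m" using mn by (auto simp: l_def)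
  have u: "0 \<le> u" "u \<le> 1" "u * (1 - \<theta>) = \<psi> \<theta>" and s: "0 \<le> s" "s \<le> 1" "s * (1 - l) = \<psi> l"
    using spectrum_classD(4)[OF _ \<psi>] spectrum_class_le_linear[OF _ \<psi>] \<theta> l
    by (auto simp: u_def s_def pos_divide_le_eq)
  have q: "real P \<le> real q" "real q \<le> real \<rho>" "real q \<le> real n" using P by (auto simp: q_def)
  have "s * (real (max P m) - real P) \<le> 1 * 1" using s P by (intro mult_mono) auto
  then have "s * (real q - real P) - 1 \<le> s * (real q - real (max P m))" by (simp add: algebra_simps)
  moreover have "u * (real \<rho> - real P) - (1 + (1 + c\<^sub>0) / \<theta>) \<le> s * (real q - real P) + (real \<rho> - real q)"
  proof (cases "l \<le> \<theta>")
    case True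
    then have "(1 - l) * \<psi> \<theta> \<le> (1 - \<theta>) * \<psi> l" using spectrum_classD(2)[OF _ \<psi>] l \<theta> by simp
    then have "u * ((1 - l) * (1 - \<theta>)) \<le> s * ((1 - l) * (1 - \<theta>))"
      by (simp flip: u(3) s(3) add: mult_ac)
    then have "u \<le> s" using l \<theta> by simp
    then have "u * (real q - real P) \<le> s * (real q - real P)" using q by (intro mult_right_mono) auto
    moreover have "u * (real \<rho> - real q) \<le> 1 * (real \<rho> - real q)" using u q by (intro mult_right_mono) auto
    moreover have "0 \<le> 1 + (1 + c\<^sub>0) / \<theta>" using \<theta> \<open>0 \<le> c\<^sub>0\<close> by simp
    ultimately show ?thesis by (simp add: algebra_simps)
  next
    case False
    then have D1: "l * \<psi> \<theta> \<le> (l - \<theta>) * 1 + \<theta> * \<psi> l" and D2: "(1 - \<theta>) * \<psi> l \<le> (1 - l) * \<psi> \<theta>"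
      using spectrum_classD(1,2)[OF _ \<psi>] l \<theta> by simp_all
    have "s * ((1 - l) * (1 - \<theta>)) \<le> u * ((1 - l) * (1 - \<theta>))"
      using D2 by (simp flip: u(3) s(3) add: mult_ac)
    then have su: "s \<le> u" using l \<theta> by simp
    have "0 \<le> (1 - s) * (real n - real q)" using s q by simp
    then have lower: "s * (real n - real P) + (real \<rho> - real n) \<le> s * (real q - real P) + (real \<rho> - real q)"
      by (simp add: algebra_simps)
    have \<rho>: "(real P - c\<^sub>0) / \<theta> \<le> real \<rho>" using P \<theta> by (simp add: pos_divide_le_eq mult.commute)
    \<comment> \<open>The rate of growth in \<open>P\<close> along the boundary line \<open>\<rho> = P / \<theta>\<close>.\<close>
    define w where "w = (1 - u) / \<theta> + (u - s)"
    have w: "0 \<le> w" using su u \<theta> by (simp add: w_def)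
    have "w \<le> 1 / \<theta> + (1 - s)"
      unfolding w_def using u \<theta> by (intro add_mono divide_right_mono) auto
    have "(1 - u) * (real P - c\<^sub>0) / \<theta> \<le> (1 - u) * real \<rho>"
      using mult_left_mono[OF \<rho>, of "1 - u"] u by simp
    moreover have "(1 - u) * (real P - c\<^sub>0) / \<theta> + (u - s) * real P = w * real P - (1 - u) * c\<^sub>0 / \<theta>"
      by (simp add: w_def algebra_simps diff_divide_distrib add_divide_distrib)
    moreover have "w * (l * n - 1) \<le> w * real P"
      using w P l by (intro mult_left_mono) auto
    moreover have "(1 - u) * c\<^sub>0 / \<theta> \<le> c\<^sub>0 / \<theta>"
      using u \<theta> \<open>0 \<le> c\<^sub>0\<close> by (intro divide_right_mono) (auto simp: mult_left_le_one_le)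
    moreover have "(1 - s) * n \<le> w * l * n"
    proof (rule mult_right_mono)
      have "(1 - s) * \<theta> \<le> w * l * \<theta>"
      proof -
        have "w * \<theta> = (1 - u) + (u - s) * \<theta>"
          using \<theta> by (simp add: w_def distrib_right)
        then have "w * l * \<theta> = (1 - u) * l + (u - s) * l * \<theta>"
          by (metis (no_types, opaque_lifting) distrib_right mult.commute mult.left_commute)
        moreover have "l * (u * (1 - \<theta>)) \<le> l - \<theta> + \<theta> * (s * (1 - l))" using D1 u s by simp
        ultimately show ?thesis by (simp add: algebra_simps)
      qed
      then show "1 - s \<le> w * l" using \<theta> by simp
    qed simp
    moreover have "w \<le> 1 / \<theta> + 1" using \<open>w \<le> 1 / \<theta> + (1 - s)\<close> s by simp
    moreover have "(1 + c\<^sub>0) / \<theta> = 1 / \<theta> + c\<^sub>0 / \<theta>" by (simp add: add_divide_distrib)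
    ultimately have "u * (real \<rho> - real P) - (1 + (1 + c\<^sub>0) / \<theta>) \<le> s * (real n - real P) + (real \<rho> - real n)"
      by (simp add: algebra_simps)
    then show ?thesis using lower by linarith
  qed
  ultimately show ?thesis by linarith
qed

text \<open>
  The two radii are rounded to powers of \<open>2\<close>. Any factor above \<open>2\<close> in place of \<open>3\<close> keeps two
  points out of a common ball of radius \<open>r\<close>, and \<open>D\<close> makes room for the passage from coordinates
  to the Euclidean norm.
\<close>
lemma separated_line_with_pieces_spectrum:
  fixes \<psi> :: "real \<Rightarrow> real"
  assumes \<psi>: "\<psi> \<in> spectrum_class 1" and \<theta>: "0 < \<theta>" "\<theta> < 1" and "1 \<le> D"
    and mn: "\<And>j. 1 \<le> m j \<and> m j < n j"
    and s: "\<And>j. s j = \<psi> (real (m j) / real (n j)) / (1 - real (m j) / real (n j))"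
  shows "\<exists>C>0. \<forall>r R x. 0 < r \<longrightarrow> r powr \<theta> \<le> R \<longrightarrow> R < 1 \<longrightarrow> x \<in> line_with_pieces m n s \<longrightarrow>
    separated (line_with_pieces m n s) x (R / D) (3 * r) (C * (R / r) powr (\<psi> \<theta> / (1 - \<theta>)))"
proof -
  let ?T = "line_with_pieces m n s"
  define u where "u = \<psi> \<theta> / (1 - \<theta>)"
  define e where "e = log 2 D"
  define c\<^sub>0 where "c\<^sub>0 = e + 4"
  define c where "c = 3 + (1 + c\<^sub>0) / \<theta> + c\<^sub>0"
  have e: "0 \<le> e" using \<open>1 \<le> D\<close> by (simp add: e_def)
  have u: "0 \<le> u" "u \<le> 1"
    using spectrum_classD(4)[OF _ \<psi>] spectrum_class_le_linear[OF _ \<psi>] \<theta>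
    by (auto simp: u_def pos_divide_le_eq)
  have s01: "0 \<le> s j \<and> s j \<le> 1" for j
    using spectrum_classD(4)[OF _ \<psi>] spectrum_class_le_linear[OF _ \<psi>] mn[of j]
    by (auto simp: s pos_divide_le_eq)
  have c: "3 + (1 + c\<^sub>0) / \<theta> \<ge> 1" "c \<ge> c\<^sub>0"
    using e \<theta> by (auto simp: c_def c\<^sub>0_def)
  have "separated ?T x (R / D) (3 * r) (2 powr (- c) * (R / r) powr u)"
    if r: "0 < r" "r powr \<theta> \<le> R" "R < 1" and x: "x \<in> ?T" for r R x
  proof -
    have R: "0 < R" using r by (smt (verit) powr_gt_zero)
    define t w where "t = - log 2 r" and "w = - log 2 R"
    have r_eq: "r = 2 powr - t" and R_eq: "R = 2 powr - w" and D_eq: "D = 2 powr e"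
      using r R \<open>1 \<le> D\<close> by (auto simp: t_def w_def e_def)
    have w: "0 < w" "w \<le> \<theta> * t"
    proof -
      show "0 < w" using r R by (simp add: w_def)
      have "log 2 (r powr \<theta>) \<le> log 2 R" using r R by (subst log_le_cancel_iff) auto
      then show "w \<le> \<theta> * t" using r by (simp add: t_def w_def log_powr)
    qed
    have M_eq: "2 powr (- c) * (R / r) powr u = 2 powr (u * (t - w) - c)"
      by (simp add: r_eq R_eq powr_powr algebra_simps flip: powr_diff powr_add)
    define P where "P = nat \<lceil>w + e\<rceil>"
    define \<rho> where "\<rho> = nat \<lfloor>t - 2\<rfloor>"
    have P: "w + e \<le> real P" "real P \<le> w + e + 1"
      using w e by (auto simp: P_def) 
    have \<rho>: "t - 3 \<le> real \<rho>" unfolding \<rho>_def by linarith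
    show ?thesis
    proof (cases "P \<le> \<rho> \<and> 2 \<le> t")
      case False
      \<comment> \<open>The two radii are comparable, so the centre alone suffices.\<close>
      have "t - w \<le> c\<^sub>0" using False P \<rho> w e unfolding c\<^sub>0_def by linarith
      then have "u * (t - w) \<le> c\<^sub>0"
      proof (cases "0 \<le> t - w")
        case True
        then show ?thesis using u mult_left_le_one_le[of "t - w" u] \<open>t - w \<le> c\<^sub>0\<close> by linarith
      next
        case False
        then have "u * (t - w) \<le> 0" using u by (intro mult_nonneg_nonpos) auto
        then show ?thesis using e by (simp add: c\<^sub>0_def)
      qed
      then have "2 powr (u * (t - w) - c) \<le> 2 powr 0" using c by (intro powr_mono) auto
      then show ?thesis unfolding M_eq using x R \<open>1 \<le> D\<close> by (intro separated_singleton) auto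
    next
      case True
      then have \<rho>2: "real \<rho> \<le> t - 2" unfolding \<rho>_def by linarith
      have "\<theta> * t \<le> \<theta> * real \<rho> + 3"
      proof -
        have "\<theta> * (t - real \<rho>) \<le> 1 * 3" using \<theta> \<rho> \<rho>2 by (intro mult_mono) auto
        then show ?thesis by (simp add: algebra_simps)
      qed
      then have P\<rho>: "real P \<le> \<theta> * real \<rho> + c\<^sub>0" using P w unfolding c\<^sub>0_def by linarith
      have radius: "1 / 2 ^ P \<le> R / D"
      proof -
        have "1 / 2 ^ P = 2 powr - real P" by (simp add: powr_minus powr_realpow inverse_eq_divide)
        also have "\<dots> \<le> 2 powr (- w - e)" using P by (intro powr_mono) auto
        also have "\<dots> = R / D" by (simp add: R_eq D_eq powr_diff)
        finally show ?thesis .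
      qed
      have gap: "3 * r \<le> 1 / 2 ^ \<rho>"
      proof -
        have "3 * r \<le> 2 powr 2 * 2 powr - t" by (simp add: r_eq)
        also have "\<dots> = 2 powr (2 - t)" using powr_add[of 2 2 "- t"] by simp
        also have "\<dots> \<le> 2 powr - real \<rho>" using \<rho>2 by (intro powr_mono) auto
        also have "\<dots> = 1 / 2 ^ \<rho>" by (simp add: powr_minus powr_realpow inverse_eq_divide)
        finally show ?thesis .
      qed
      have gain: "u * (t - w) - c \<le> u * (real \<rho> - real P) - (3 + (1 + c\<^sub>0) / \<theta>)"
      proof -
        have "u * ((t - w) - (real \<rho> - real P)) \<le> 1 * c\<^sub>0"
          using u P \<rho> \<rho>2 e unfolding c\<^sub>0_def by (intro mult_mono) auto
        then show ?thesis by (simp add: c_def algebra_simps)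
      qed
      have enough: "separated ?T x (R / D) (3 * r) (2 powr (u * (t - w) - c))"
        if "separated ?T x (1 / 2 ^ P) (1 / 2 ^ \<rho>) (2 powr E)"
          "u * (real \<rho> - real P) - (3 + (1 + c\<^sub>0) / \<theta>) \<le> E" for E
      proof (rule separated_mono[OF that(1) order_refl])
        show "2 powr (u * (t - w) - c) \<le> 2 powr E" using gain that(2) by (intro powr_mono) auto
      qed (use radius gap in auto)
      have "u * (real \<rho> - real P) \<le> 1 * (real \<rho> - real P)"
        using u True by (intro mult_right_mono) auto
      then have full: "u * (real \<rho> - real P) - (3 + (1 + c\<^sub>0) / \<theta>) \<le> real \<rho> - real P - 1"
        using diff_mono[OF _ c(1)] by simp
      have "separated ?T x (1 / 2 ^ P) (1 / 2 ^ \<rho>) (2 powr (real \<rho> - real P - 1)) \<or>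
        (\<exists>j. m j \<le> P + 1 \<and> P \<le> n j \<and>
          separated ?T x (1 / 2 ^ P) (1 / 2 ^ \<rho>)
            (2 powr (s j * (real (min \<rho> (n j)) - real (max P (m j))) + (real \<rho> - real (min \<rho> (n j))) - 1)))"
        using mn s01 x True by (intro separated_line_with_pieces) (auto intro: less_imp_le)
      then show ?thesis unfolding M_eq
      proof (elim disjE exE conjE)
        fix j assume j: "m j \<le> P + 1" "P \<le> n j"
          and sep: "separated ?T x (1 / 2 ^ P) (1 / 2 ^ \<rho>)
            (2 powr (s j * (real (min \<rho> (n j)) - real (max P (m j))) + (real \<rho> - real (min \<rho> (n j))) - 1))"
        have "0 \<le> c\<^sub>0" using e by (simp add: c\<^sub>0_def)
        then have "u * (real \<rho> - real P) - (3 + (1 + c\<^sub>0) / \<theta>)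
          \<le> s j * (real (min \<rho> (n j)) - real (max P (m j))) + (real \<rho> - real (min \<rho> (n j))) - 1"
          unfolding u_def s using \<psi> \<theta> mn[of j] True P\<rho> j by (intro spectrum_exponent_bound) auto
        then show "separated ?T x (R / D) (3 * r) (2 powr (u * (t - w) - c))"
          by (rule enough[OF sep])
      qed (use enough full in blast)
    qed
  qed
  then show ?thesis unfolding u_def by (intro exI[of _ "2 powr (- c)"]) auto
qed

section \<open>The set attaining a given spectrum\<close>

definition cube :: "real set \<Rightarrow> (real ^ 'n) set" where
  "cube T = {y. \<forall>i. y $ i \<in> T}"

lemma finite_cube_choice:
  fixes G :: "'n::finite \<Rightarrow> real set"
  assumes "\<And>i. finite (G i)"
  shows "finite {y :: real ^ 'n. \<forall>i. y $ i \<in> G i}"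
    and "card {y :: real ^ 'n. \<forall>i. y $ i \<in> G i} = (\<Prod>i\<in>UNIV. card (G i))"
proof -
  have eq: "{y :: real ^ 'n. \<forall>i. y $ i \<in> G i} = vec_lambda ` (PiE UNIV G)"
  proof (intro equalityI subsetI)
    fix y :: "real ^ 'n" assume "y \<in> {y. \<forall>i. y $ i \<in> G i}"
    then show "y \<in> vec_lambda ` (PiE UNIV G)"
      by (intro image_eqI[of _ _ "vec_nth y"]) auto
  qed auto
  have "inj_on (vec_lambda :: ('n \<Rightarrow> real) \<Rightarrow> _) (PiE UNIV G)"
    by (rule inj_onI) (simp add: vec_lambda_inject)
  then show "card {y :: real ^ 'n. \<forall>i. y $ i \<in> G i} = (\<Prod>i\<in>UNIV. card (G i))"
    unfolding eq by (simp add: card_image card_PiE)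
  show "finite {y :: real ^ 'n. \<forall>i. y $ i \<in> G i}"
    unfolding eq using assms by (intro finite_imageI finite_PiE) auto
qed

lemma norm_le_coordinates:
  fixes x :: "real ^ 'n"
  assumes "\<And>i. \<bar>x $ i\<bar> \<le> R / real CARD('n)"
  shows "norm x \<le> R"
proof -
  have "norm x \<le> (\<Sum>i\<in>(UNIV::'n set). R / real CARD('n))"
    using assms by (intro order_trans[OF norm_le_l1_cart] sum_mono) simp
  then show ?thesis by simp
qed

text \<open>
  The product of separated sets in the coordinates is separated, and distinct points of it lie in
  distinct balls of the cover.
\<close>
lemma finite_cover_cube_lower:
  fixes x :: "real ^ 'n"
  assumes sep: "\<And>y. y \<in> T \<Longrightarrow> separated T y (R / real CARD('n)) \<epsilon> M"
    and "2 * r < \<epsilon>" "0 \<le> M" and x: "x \<in> cube T"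
    and K: "finite_cover (cube T) r (cube T \<inter> cball x R) K"
  shows "M ^ CARD('n) \<le> real (card K)"
proof -
  have "\<exists>G. finite G \<and> G \<subseteq> T \<and> (\<forall>g\<in>G. \<bar>g - x $ i\<bar> \<le> R / real CARD('n)) \<and>
     (\<forall>g\<in>G. \<forall>h\<in>G. g \<noteq> h \<longrightarrow> \<epsilon> \<le> \<bar>g - h\<bar>) \<and> M \<le> real (card G)" for i
    using sep[of "x $ i"] x unfolding separated_def by (simp add: cube_def)
  then obtain G where G: "\<And>i. finite (G i)" "\<And>i. G i \<subseteq> T"
    "\<And>i g. g \<in> G i \<Longrightarrow> \<bar>g - x $ i\<bar> \<le> R / real CARD('n)"
    "\<And>i g h. g \<in> G i \<Longrightarrow> h \<in> G i \<Longrightarrow> g \<noteq> h \<Longrightarrow> \<epsilon> \<le> \<bar>g - h\<bar>"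
    "\<And>i. M \<le> real (card (G i))"
    by metis
  define Q where "Q = {y :: real ^ 'n. \<forall>i. y $ i \<in> G i}"
  have "Q \<subseteq> cube T \<inter> cball x R"
  proof
    fix y assume y: "y \<in> Q"
    have "norm (y - x) \<le> R" using y G(3) by (intro norm_le_coordinates) (simp add: Q_def)
    then show "y \<in> cube T \<inter> cball x R"
      using y G(2) by (auto simp: Q_def cube_def dist_norm norm_minus_commute)
  qed
  then have "Q \<subseteq> (\<Union>y\<in>K. cball y r)" using K by (auto simp: finite_cover_def)
  then have "\<forall>y\<in>Q. \<exists>k\<in>K. dist k y \<le> r" by fastforce
  then obtain k where k: "\<And>y. y \<in> Q \<Longrightarrow> k y \<in> K" "\<And>y. y \<in> Q \<Longrightarrow> dist (k y) y \<le> r" by metis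
  have "inj_on k Q"
  proof (rule inj_onI, rule ccontr)
    fix y z assume yz: "y \<in> Q" "z \<in> Q" "k y = k z" "y \<noteq> z"
    then obtain i where i: "y $ i \<noteq> z $ i" by (auto simp: vec_eq_iff)
    have "\<epsilon> \<le> \<bar>y $ i - z $ i\<bar>" using G(4)[of "y $ i" i "z $ i"] yz i by (simp add: Q_def)
    also have "\<dots> \<le> dist y z" using component_le_norm_cart[of "y - z" i] by (simp add: dist_norm)
    also have "\<dots> \<le> 2 * r"
      using dist_triangle3[of y z "k y"] k(2)[OF yz(1)] k(2)[OF yz(2)] yz(3) by simp
    finally show False using \<open>2 * r < \<epsilon>\<close> by simp
  qed
  then have "card Q \<le> card K"
    using k(1) K by (intro card_inj_on_le) (auto simp: finite_cover_def)
  have "M ^ CARD('n) = (\<Prod>i\<in>(UNIV::'n set). M)" by simp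
  also have "\<dots> \<le> (\<Prod>i\<in>(UNIV::'n set). real (card (G i)))"
    using G(5) \<open>0 \<le> M\<close> by (intro prod_mono) auto
  also have "\<dots> = real (card Q)"
    unfolding Q_def using finite_cube_choice(2)[of G] G(1) by simp
  finally show ?thesis using \<open>card Q \<le> card K\<close> by simp
qed

lemma finite_cover_cube_upper:
  fixes x :: "real ^ 'n"
  assumes "finite H" "H \<subseteq> T"
    and near: "\<And>y. y \<in> E \<Longrightarrow> \<exists>h\<in>H. \<bar>y - h\<bar> \<le> r / real CARD('n)"
    and E: "\<And>i y. y \<in> T \<Longrightarrow> \<bar>y - x $ i\<bar> \<le> R \<Longrightarrow> y \<in> E"
  shows "\<exists>K. finite_cover (cube T) r (cube T \<inter> cball x R) K \<and> card K = card H ^ CARD('n)"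
proof -
  define K where "K = (cube H :: (real ^ 'n) set)"
  have "finite K" "card K = card H ^ CARD('n)"
    using finite_cube_choice[of "\<lambda>i::'n. H"] assms(1) by (auto simp: K_def cube_def)
  moreover have "K \<subseteq> cube T" using assms(2) by (auto simp: K_def cube_def)
  moreover have "cube T \<inter> cball x R \<subseteq> (\<Union>k\<in>K. cball k r)"
  proof
    fix y assume y: "y \<in> cube T \<inter> cball x R"
    have "\<bar>y $ i - x $ i\<bar> \<le> R" for i
      using component_le_norm_cart[of "y - x" i] y by (simp add: dist_norm norm_minus_commute)
    then have "y $ i \<in> E" for i using y by (intro E) (auto simp: cube_def)
    then have "\<forall>i. \<exists>h\<in>H. \<bar>y $ i - h\<bar> \<le> r / real CARD('n)" using near by blast
    then obtain h where h: "\<And>i. h i \<in> H" "\<And>i. \<bar>y $ i - h i\<bar> \<le> r / real CARD('n)" by metis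
    have "norm (y - vec_lambda h) \<le> r" using h(2) by (intro norm_le_coordinates) simp
    moreover have "vec_lambda h \<in> K" using h(1) by (simp add: K_def cube_def)
    ultimately show "y \<in> (\<Union>k\<in>K. cball k r)" by (auto simp: dist_norm norm_minus_commute)
  qed
  ultimately show ?thesis unfolding finite_cover_def by blast
qed

text \<open>
  At the scale \<open>2^-n\<close> of its intervals a piece is exhausted by its free digits; dividing each
  interval into \<open>d\<close> parts makes the product net fine enough for the Euclidean norm.
\<close>
lemma digit_piece_net:
  assumes "1 \<le> d"
  obtains H where "finite H" "H \<subseteq> digit_piece p m n s"
    "card H \<le> (d + 1) * 2 ^ card (beatty_digits s \<inter> {..<n - m})"
    "\<And>y. y \<in> digit_piece p m n s \<Longrightarrow> \<exists>h\<in>H. \<bar>y - h\<bar> \<le> (1 / 2 ^ n) / real d"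
proof -
  define A where "A = beatty_digits s \<inter> {..<n - m}"
  define f where "f = (\<lambda>(B, i). p + (real (set_encode B) + real i / real d) / 2 ^ n)"
  define H where "H = f ` (Pow A \<times> {..d})"
  have A: "finite A" by (simp add: A_def)
  have "finite H" unfolding H_def using A by simp
  moreover have "H \<subseteq> digit_piece p m n s"
  proof
    fix h assume "h \<in> H"
    then obtain B i where "B \<subseteq> A" "i \<le> d" "h = p + (real (set_encode B) + real i / real d) / 2 ^ n"
      unfolding H_def f_def by auto
    moreover from this have "real i / real d \<le> 1" using assms by simp
    ultimately show "h \<in> digit_piece p m n s"
      unfolding digit_piece_def A_def[symmetric] by (auto intro!: imageI digit_sumsI)
  qed
  moreover have "card H \<le> (d + 1) * 2 ^ card A"
  proof -
    have "card H \<le> card (Pow A \<times> {..d})" unfolding H_def using A by (intro card_image_le) simp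
    also have "\<dots> = (d + 1) * 2 ^ card A" using A by (simp add: card_cartesian_product card_Pow)
    finally show ?thesis .
  qed
  moreover have "\<exists>h\<in>H. \<bar>y - h\<bar> \<le> (1 / 2 ^ n) / real d" if "y \<in> digit_piece p m n s" for y
  proof -
    obtain B v where B: "B \<subseteq> A" and v: "0 \<le> v" "v \<le> 1" and y: "y = p + (real (set_encode B) + v) / 2 ^ n"
      using \<open>y \<in> _\<close> unfolding digit_piece_def digit_sums_def A_def by blast
    define i where "i = nat \<lfloor>v * d\<rfloor>"
    have i: "real i \<le> v * d" "v * d \<le> real i + 1" using v by (auto simp: i_def)
    have "v * d \<le> 1 * real d" using v by (intro mult_right_mono) auto
    then have "i \<le> d" using i(1) by simp
    have "real i / d \<le> v" "v - real i / d \<le> 1 / d"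
      using i assms by (simp_all add: pos_divide_le_eq pos_le_divide_eq left_diff_distrib)
    then have "\<bar>v - real i / d\<bar> / 2 ^ n \<le> (1 / d) / 2 ^ n" by (intro divide_right_mono) auto
    moreover have "\<bar>y - f (B, i)\<bar> = \<bar>v - real i / d\<bar> / 2 ^ n"
      unfolding y f_def by (simp flip: diff_divide_distrib)
    moreover have "f (B, i) \<in> H" using B \<open>i \<le> d\<close> by (auto simp: H_def)
    ultimately show ?thesis by (intro bexI[of _ "f (B, i)"]) (simp_all add: mult.commute)
  qed
  ultimately show ?thesis using that unfolding A_def by blast
qed

lemma spectrum_class_divide:
  assumes "\<phi> \<in> spectrum_class \<alpha>" "0 < \<alpha>"
  shows "(\<lambda>x. \<phi> x / \<alpha>) \<in> spectrum_class 1"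
proof -
  have \<alpha>: "0 \<le> \<alpha>" using assms by simp
  have div: "y * (\<phi> x / \<alpha>) \<le> (y - x) * 1 + x * (\<phi> y / \<alpha>) \<and>
      (1 - x) * (\<phi> y / \<alpha>) \<le> (1 - y) * (\<phi> x / \<alpha>)" if xy: "0 < x" "x \<le> y" "y \<le> 1" for x y
  proof
    have "y * \<phi> x / \<alpha> \<le> ((y - x) * \<alpha> + x * \<phi> y) / \<alpha>"
      using spectrum_classD(1)[OF \<alpha> assms(1) xy] \<alpha> by (rule divide_right_mono)
    then show "y * (\<phi> x / \<alpha>) \<le> (y - x) * 1 + x * (\<phi> y / \<alpha>)"
      using assms(2) by (simp add: add_divide_distrib)
    show "(1 - x) * (\<phi> y / \<alpha>) \<le> (1 - y) * (\<phi> x / \<alpha>)"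
      using divide_right_mono[OF spectrum_classD(2)[OF \<alpha> assms(1) xy] \<alpha>] by simp
  qed
  have "(\<lambda>x. \<phi> x / \<alpha>) \<in> {0<..1} \<rightarrow> {0..1}"
    using assms(1,2) by (auto simp: spectrum_class_def Pi_iff)
  moreover have "\<phi> 1 / \<alpha> = 0" using spectrum_classD(3)[OF \<alpha> assms(1)] by simp
  ultimately show ?thesis unfolding spectrum_class_iff[OF zero_le_one] using div by blast
qed

text \<open>
  The pieces run through all pairs \<open>1 \<le> m < n\<close>. The lower bound is the separation
  estimate of the line in each coordinate. For the upper bound at \<open>\<theta>\<close> take the pieces with
  \<open>m = \<lfloor>\<theta> n\<rfloor>\<close>, radii \<open>2^-n\<close> and \<open>2^-m\<close>: their \<open>l = m / n\<close> tends to \<open>\<theta>\<close>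
  from below, and the first inequality of the class bounds \<open>n * \<phi> l\<close> by \<open>n * \<phi> \<theta>\<close> plus a constant, so
  that irrational \<open>\<theta>\<close> require no limit argument of their own.
\<close>
theorem spectrum_class_attained:
  fixes \<phi> :: "real \<Rightarrow> real"
  assumes \<phi>: "\<phi> \<in> spectrum_class (real CARD('n))"
  shows "\<exists>F :: (real ^ 'n) set. F \<noteq> {} \<and>
    (\<forall>\<theta>\<in>{0<..1}. scaled_monotone_lower_spectrum \<theta> F = ereal (\<phi> \<theta>))"
proof -
  define d where "d = CARD('n)"
  have d: "1 \<le> d" "0 < real d" by (auto simp: d_def Suc_le_eq)
  have \<phi>d: "\<phi> \<in> spectrum_class (real d)" using \<phi> by (simp add: d_def)
  define \<psi> where "\<psi> = (\<lambda>x. \<phi> x / real d)"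
  have \<psi>: "\<psi> \<in> spectrum_class 1"
    unfolding \<psi>_def using \<phi>d d(2) by (rule spectrum_class_divide)
  define m n :: "nat \<Rightarrow> nat" where "m j = 1 + fst (prod_decode j)"
    and "n j = m j + 1 + snd (prod_decode j)" for j
  have mn: "1 \<le> m j \<and> m j < n j" for j by (simp add: m_def n_def)
  have mn_surj: "\<exists>j. m j = a \<and> n j = b" if "1 \<le> a" "a < b" for a b
    by (rule exI[of _ "prod_encode (a - 1, b - a - 1)"]) (use that in \<open>simp add: m_def n_def\<close>)
  define s where "s j = \<psi> (real (m j) / real (n j)) / (1 - real (m j) / real (n j))" for j
  have s01: "0 \<le> s j \<and> s j \<le> 1" for j
    using spectrum_classD(4)[OF _ \<psi>] spectrum_class_le_linear[OF _ \<psi>] mn[of j]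
    by (auto simp: s_def pos_divide_le_eq)
  define T where "T = line_with_pieces m n s"
  define F :: "(real ^ 'n) set" where "F = cube T"
  have centre: "10 * real j \<in> T" for j
  proof -
    have "real (set_encode {}) + 0 \<in> digit_sums (beatty_digits (s j) \<inter> {..<n j - m j})"
      by (rule digit_sumsI) auto
    then have "10 * real j + 0 / 2 ^ n j \<in> digit_piece (10 * real j) (m j) (n j) (s j)"
      unfolding digit_piece_def by (intro image_eqI[of _ _ 0]) auto
    then show ?thesis unfolding T_def line_with_pieces_def by auto
  qed
  have "(\<chi> i. 10 * real 0) \<in> F" unfolding F_def cube_def using centre[of 0] by simp
  then have "F \<noteq> {}" by blast
  have lower: "lower_exponent \<theta> F (\<phi> \<theta> / (1 - \<theta>))" if \<theta>: "0 < \<theta>" "\<theta> < 1" for \<theta>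
  proof -
    define u where "u = \<psi> \<theta> / (1 - \<theta>)"
    obtain C where "0 < C" and C: "\<And>r R x. 0 < r \<Longrightarrow> r powr \<theta> \<le> R \<Longrightarrow> R < 1 \<Longrightarrow> x \<in> T \<Longrightarrow>
        separated T x (R / real d) (3 * r) (C * (R / r) powr u)"
      using separated_line_with_pieces_spectrum[OF \<psi> \<theta>, of "real d" m n s] d mn s_def
      unfolding T_def u_def by auto
    have ud: "u * real d = \<phi> \<theta> / (1 - \<theta>)" using d by (simp add: u_def \<psi>_def)
    have "C ^ d * (R / r) powr (\<phi> \<theta> / (1 - \<theta>)) \<le> real (card K)"
      if r: "0 < r" "r powr \<theta> \<le> R" "R < 1" "x \<in> F" "finite_cover F r (F \<inter> cball x R) K" for r R x K
    proof -
      have "0 < R" using r by (smt (verit) powr_gt_zero)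
      have "(C * (R / r) powr u) ^ CARD('n) \<le> real (card K)"
        using C[unfolded d_def] r \<open>0 < C\<close> unfolding F_def
        by (intro finite_cover_cube_lower[where \<epsilon> = "3 * r"]) auto
      moreover have "(C * (R / r) powr u) ^ d = C ^ d * (R / r) powr (u * real d)"
        using \<open>0 < R\<close> r by (simp add: power_mult_distrib powr_powr flip: powr_realpow)
      ultimately show ?thesis unfolding ud d_def[symmetric] by simp
    qed
    moreover have "0 \<le> \<phi> \<theta> / (1 - \<theta>)" using spectrum_classD(4)[OF _ \<phi>d] \<theta> by simp
    ultimately show ?thesis
      unfolding lower_exponent_def using \<open>0 < C\<close> by (intro conjI exI[of _ "C ^ d"]) auto
  qed
  have upper: "\<sigma> \<le> \<phi> \<theta> / (1 - \<theta>)" if \<theta>: "0 < \<theta>" "\<theta> < 1" and \<sigma>: "lower_exponent \<theta> F \<sigma>" for \<theta> \<sigma>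
  proof -
    obtain C where "0 < C" "0 \<le> \<sigma>" and C: "\<And>r R x K. 0 < r \<Longrightarrow> r \<le> r powr \<theta> \<Longrightarrow>
        r powr \<theta> \<le> R \<Longrightarrow> R < 1 \<Longrightarrow> x \<in> F \<Longrightarrow> finite_cover F r (F \<inter> cball x R) K \<Longrightarrow>
        C * (R / r) powr \<sigma> \<le> real (card K)"
      using \<sigma> unfolding lower_exponent_def by blast
    have "(1 - \<theta>) * \<sigma> \<le> \<phi> \<theta>"
    proof (rule slope_le_if_linear_growth_le)
      fix b :: nat assume b: "nat \<lceil>1 / \<theta>\<rceil> + 1 \<le> b"
      define a where "a = nat \<lfloor>\<theta> * b\<rfloor>"
      have "1 / \<theta> \<le> real b" "1 \<le> b" using b by linarith+
      then have "1 \<le> \<theta> * b" using \<theta> by (simp add: pos_divide_le_eq mult.commute)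
      then have a: "1 \<le> a" "real a \<le> \<theta> * b" "\<theta> * b \<le> real a + 1" unfolding a_def by linarith+
      have "\<theta> * b < 1 * real b" using \<theta> \<open>1 \<le> b\<close> by (intro mult_strict_right_mono) auto
      then have ab: "a < b" using a by simp
      obtain j where j: "m j = a" "n j = b" using mn_surj[OF a(1) ab] by blast
      define l where "l = real a / real b"
      have l: "0 < l" "l \<le> \<theta>" "l < 1" "l * b = a"
        using a ab \<theta> by (auto simp: l_def pos_divide_le_eq)
      define p where "p = 10 * real j"
      define x :: "real ^ 'n" where "x = (\<chi> i. p)"
      have x: "x \<in> F" using centre[of j] by (simp add: F_def cube_def x_def p_def)
      define r R :: real where "r = 1 / 2 ^ b" and "R = 1 / 2 ^ a"
      have powr_eq: "r = 2 powr - real b" "R = 2 powr - real a"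
        by (simp_all add: r_def R_def powr_minus powr_realpow inverse_eq_divide)
      have rR: "0 < r" "r \<le> r powr \<theta>" "r powr \<theta> \<le> R" "R < 1"
      proof -
        show "0 < r" by (simp add: r_def)
        show "r \<le> r powr \<theta>" unfolding powr_eq powr_powr
          using \<open>\<theta> * b < 1 * real b\<close> by (intro powr_mono) (auto simp: mult.commute)
        show "r powr \<theta> \<le> R" unfolding powr_eq powr_powr
          using a by (intro powr_mono) (auto simp: mult.commute)
        have "2 powr - real a < 2 powr 0" using a by (intro powr_less_mono) auto
        then show "R < 1" by (simp add: powr_eq)
      qed
      define N where "N = card (beatty_digits (s j) \<inter> {..<b - a})"
      obtain H where H: "finite H" "H \<subseteq> digit_piece p a b (s j)" "card H \<le> (d + 1) * 2 ^ N"
        "\<And>y. y \<in> digit_piece p a b (s j) \<Longrightarrow> \<exists>h\<in>H. \<bar>y - h\<bar> \<le> r / real d"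
        unfolding N_def r_def by (rule digit_piece_net[OF d(1)]) blast
      have "H \<subseteq> T" using H(2) j by (auto simp: T_def line_with_pieces_def p_def)
      have "y \<in> digit_piece p a b (s j)" if "y \<in> T" "\<bar>y - x $ i\<bar> \<le> R" for y i
        using line_with_pieces_near[of m n y s j] mn that j
        by (auto simp: T_def x_def p_def R_def less_imp_le)
      then obtain K where K: "finite_cover F r (F \<inter> cball x R) K" "card K = card H ^ d"
        using finite_cover_cube_upper[OF H(1) \<open>H \<subseteq> T\<close> H(4)[unfolded d_def]]
        unfolding F_def d_def by blast
      have Nle: "real N \<le> b * \<psi> l"
      proof -
        have "real N \<le> s j * real (b - a)"
          unfolding N_def using card_beatty_digits_bounds(2)[of "s j" 0 "b - a"] s01
          by (simp add: lessThan_atLeast0)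
        also have "real (b - a) = b * (1 - l)" using ab l by (simp add: algebra_simps)
        also have "s j * (b * (1 - l)) = b * \<psi> l"
          using l(3) by (simp add: s_def j flip: l_def)
        finally show ?thesis .
      qed
      have "C * (R / r) powr \<sigma> \<le> real (card K)" using C[OF rR x K(1)] .
      also have "\<dots> \<le> real (((d + 1) * 2 ^ N) ^ d)"
        unfolding K(2) using H(3) by (intro of_nat_mono power_mono) auto
      also have "\<dots> = (real d + 1) ^ d * 2 powr (real d * real N)"
      proof -
        have "2 powr (real d * real N) = (2 powr real N) ^ d"
          by (simp add: powr_powr mult.commute flip: powr_realpow)
        then show ?thesis by (simp add: powr_realpow add.commute distrib_right flip: power_mult_distrib)
      qed
      finally have "C * 2 powr ((real b - real a) * \<sigma>) \<le> (real d + 1) ^ d * 2 powr (real d * real N)"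
        by (simp add: powr_eq powr_powr flip: powr_diff)
      then have "log 2 (C * 2 powr ((real b - real a) * \<sigma>)) \<le> log 2 ((real d + 1) ^ d * 2 powr (real d * real N))"
        using \<open>0 < C\<close> by (subst log_le_cancel_iff) (auto intro!: mult_pos_pos zero_less_power)
      then have logs: "log 2 C + (real b - real a) * \<sigma> \<le> log 2 ((real d + 1) ^ d) + real d * real N"
        using \<open>0 < C\<close> by (simp add: log_mult)
      have "real d * real N \<le> real d * (b * \<psi> l)" using Nle by (intro mult_left_mono) auto
      also have "\<dots> = b * \<phi> l" using d by (simp add: \<psi>_def)
      also have "\<dots> \<le> b * \<phi> \<theta> + d / \<theta>"
      proof -
        have "\<theta> * \<phi> l \<le> (\<theta> - l) * d + l * \<phi> \<theta>" using spectrum_classD(1)[OF _ \<phi>d l(1,2)] \<theta> by simp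
        then have "b * (\<theta> * \<phi> l) \<le> b * ((\<theta> - l) * d + l * \<phi> \<theta>)" by (intro mult_left_mono) auto
        also have "\<dots> = (\<theta> * b - a) * d + a * \<phi> \<theta>" using l(4) by (simp add: algebra_simps flip: l(4))
        also have "\<dots> \<le> 1 * real d + (\<theta> * b) * \<phi> \<theta>"
          using a spectrum_classD(4)[OF _ \<phi>d] \<theta> by (intro add_mono mult_right_mono) auto
        finally have "b * \<phi> l * \<theta> \<le> (b * \<phi> \<theta> + d / \<theta>) * \<theta>" using \<theta> by (simp add: algebra_simps)
        then show ?thesis using \<theta> by simp
      qed
      finally have "real d * real N \<le> b * \<phi> \<theta> + d / \<theta>" .
      moreover have "(1 - \<theta>) * b * \<sigma> \<le> (real b - real a) * \<sigma>"
        using a \<open>0 \<le> \<sigma>\<close> by (intro mult_right_mono) (auto simp: algebra_simps)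
      ultimately show "(1 - \<theta>) * \<sigma> * real b \<le> \<phi> \<theta> * real b + (log 2 ((real d + 1) ^ d) + d / \<theta> - log 2 C)"
        using logs by (simp add: mult_ac)
    qed
    then show ?thesis using \<theta> by (simp add: pos_le_divide_eq mult.commute)
  qed
  have "scaled_monotone_lower_spectrum \<theta> F = ereal (\<phi> \<theta>)" if \<theta>: "\<theta> \<in> {0<..1}" for \<theta>
  proof (cases "\<theta> = 1")
    case True
    then show ?thesis
      using spectrum_classD(3)[OF _ \<phi>d] by (simp add: scaled_monotone_lower_spectrum_def zero_ereal_def)
  next
    case False
    have "Sup (ereal ` {s. lower_exponent \<theta> F s}) = ereal (\<phi> \<theta> / (1 - \<theta>))"
      using lower upper \<theta> False by (intro antisym Sup_least Sup_upper) auto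
    then show ?thesis
      using \<theta> False by (simp add: scaled_monotone_lower_spectrum_def monotone_lower_spectrum_eq)
  qed
  then show ?thesis using \<open>F \<noteq> {}\<close> by blast
qed

section \<open>The equivalence\<close>

theorem theorem3p14:
  fixes \<phi> :: "real \<Rightarrow> real" and d :: nat
  assumes d: "d = CARD('n::finite)"
    and \<phi>: "\<phi> \<in> {0<..1} \<rightarrow> {0..real d}"
  shows "(\<phi> \<in> spectrum_class (real d) \<longleftrightarrow>
            (\<exists>F :: (real ^ 'n) set. F \<noteq> {} \<and>
               (\<forall>\<theta>\<in>{0<..1}. scaled_monotone_lower_spectrum \<theta> F = ereal (\<phi> \<theta>))))
       \<and> ((\<exists>F :: (real ^ 'n) set. F \<noteq> {} \<and>
               (\<forall>\<theta>\<in>{0<..1}. scaled_monotone_lower_spectrum \<theta> F = ereal (\<phi> \<theta>))) \<longleftrightarrow>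
          (\<exists>P. P \<noteq> {} \<and> P \<subseteq> {(l, t). 0 < l \<and> l \<le> 1 \<and> 0 \<le> t \<and> t \<le> real d * (1 - l)} \<and>
               (\<forall>\<theta>\<in>{0<..1}. \<phi> \<theta> = (INF (l, t)\<in>P. basic_fun (real d) l t \<theta>))))"
proof -
  have "\<phi> \<in> spectrum_class (real d) \<longleftrightarrow> (\<exists>F :: (real ^ 'n) set. F \<noteq> {} \<and>
      (\<forall>\<theta>\<in>{0<..1}. scaled_monotone_lower_spectrum \<theta> F = ereal (\<phi> \<theta>)))"
    using spectrum_class_attained[where 'n = 'n] scaled_spectrum_in_spectrum_class[where 'n = 'n] \<phi>
    unfolding d by blast
  moreover note spectrum_class_iff_Inf_basic_fun[OF of_nat_0_le_iff \<phi>]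
  ultimately show ?thesis by argo
qed

end
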